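(* Let $m\geq 3$ and $n\geq 2$ be integers, let $C_m$ be the cycle of order $m$ and $K_n$ the complete graph of order $n$. Then $$rvcl(C_m\diamond K_n)=\begin{cases} n+1, & \text{if } m=3, \text{ or } m\geq 4 \text{ and } n\geq m-1;\\ \max\{\lceil m/2\rceil+1,\, n+2\}, & \text{if } m\geq 4 \text{ and } \lceil m/2\rceil-1\leq n< m-1;\\ \lceil m/2\rceil, & \text{if } m\geq 5 \text{ and } n\leq \lceil m/2\rceil-2.\end{cases}$$
   Context: All graphs are finite, simple, connected and undirected; $d$ denotes graph distance. A rainbow vertex $k$-coloring of $G$ is a map $c:V(G)\to\{1,\dots,k\}$ such that every two vertices are joined by a path whose internal vertices all receive distinct colors. For such $c$ let $R_i=c^{-1}(i)$; the rainbow code of $v$ is $(d(v,R_1),\dots,d(v,R_k))$ with $d(v,R_i)=\min_{x\in R_i}d(v,x)$. A locating rainbow $k$-coloring is a rainbow vertex $k$-coloring in which distinct vertices have distinct rainbow codes; $rvcl(G)$ is the least $k$ for which one exists. For graphs $G_m$ (order $m$) and $H_n$ (order $n$) on disjoint vertex sets, the edge corona $G_m\diamond H_n$ is obtained from one copy of $G_m$ and $|E(G_m)|$ vertex-disjoint copies of $H_n$, one per edge of $G_m$, by joining both end vertices of the $j$-th edge of $G_m$ to every vertex of the $j$-th copy of $H_n$. *)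

theory Defs
  imports Complex_Main "HOL-Library.Extended_Nat"
begin

text \<open>A (simple, undirected) graph is a pair (V, E) of a vertex set and a set of
  edges, each edge being a 2-element subset of V.\<close>
type_synonym 'a graph = "'a set \<times> 'a set set"

definition verts :: "'a graph \<Rightarrow> 'a set" where "verts G = fst G"
definition edges :: "'a graph \<Rightarrow> 'a set set" where "edges G = snd G"

definition adj :: "'a graph \<Rightarrow> 'a \<Rightarrow> 'a \<Rightarrow> bool" where
  "adj G u v \<longleftrightarrow> u \<noteq> v \<and> {u, v} \<in> edges G"

definition is_walk :: "'a graph \<Rightarrow> 'a list \<Rightarrow> bool" where
  "is_walk G xs \<longleftrightarrow> xs \<noteq> [] \<and> set xs \<subseteq> verts G \<and>
     (\<forall>i. Suc i < length xs \<longrightarrow> adj G (xs ! i) (xs ! Suc i))"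

definition is_path :: "'a graph \<Rightarrow> 'a list \<Rightarrow> bool" where
  "is_path G xs \<longleftrightarrow> is_walk G xs \<and> distinct xs"

text \<open>Graph distance (infinite if no walk exists).\<close>
definition gdist :: "'a graph \<Rightarrow> 'a \<Rightarrow> 'a \<Rightarrow> enat" where
  "gdist G u v = Inf {enat (length xs - 1) | xs. is_walk G xs \<and> hd xs = u \<and> last xs = v}"

text \<open>Distance from a vertex to a set of vertices (infinite for the empty set).\<close>
definition set_dist :: "'a graph \<Rightarrow> 'a \<Rightarrow> 'a set \<Rightarrow> enat" where
  "set_dist G v R = (INF x\<in>R. gdist G v x)"

definition internal :: "'a list \<Rightarrow> 'a list" where
  "internal xs = butlast (tl xs)"

definition rainbow_vertex_coloring :: "'a graph \<Rightarrow> nat \<Rightarrow> ('a \<Rightarrow> nat) \<Rightarrow> bool" where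
  "rainbow_vertex_coloring G k c \<longleftrightarrow>
     (\<forall>v\<in>verts G. c v \<in> {1..k}) \<and>
     (\<forall>u\<in>verts G. \<forall>v\<in>verts G. u \<noteq> v \<longrightarrow>
        (\<exists>xs. is_path G xs \<and> hd xs = u \<and> last xs = v \<and> distinct (map c (internal xs))))"

definition color_class :: "'a graph \<Rightarrow> ('a \<Rightarrow> nat) \<Rightarrow> nat \<Rightarrow> 'a set" where
  "color_class G c i = {x \<in> verts G. c x = i}"

definition rainbow_code :: "'a graph \<Rightarrow> nat \<Rightarrow> ('a \<Rightarrow> nat) \<Rightarrow> 'a \<Rightarrow> enat list" where
  "rainbow_code G k c v = map (\<lambda>i. set_dist G v (color_class G c i)) [1..<Suc k]"

definition locating_rainbow_coloring :: "'a graph \<Rightarrow> nat \<Rightarrow> ('a \<Rightarrow> nat) \<Rightarrow> bool" where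
  "locating_rainbow_coloring G k c \<longleftrightarrow> rainbow_vertex_coloring G k c \<and>
     inj_on (rainbow_code G k c) (verts G)"

definition rvcl :: "'a graph \<Rightarrow> nat" where
  "rvcl G = (LEAST k. \<exists>c. locating_rainbow_coloring G k c)"

text \<open>Edge corona G \<diamond> H: a copy of G (vertices Inl v), and for every edge e of G a copy
  of H (vertices Inr (e, w)), both ends of e joined to every vertex of the copy for e.\<close>
definition edge_corona :: "'a graph \<Rightarrow> 'b graph \<Rightarrow> ('a + ('a set \<times> 'b)) graph" where
  "edge_corona G H =
    (Inl ` verts G \<union> Inr ` (edges G \<times> verts H),
     {{Inl u, Inl v} | u v. {u, v} \<in> edges G} \<union>
     {{Inr (e, w), Inr (e, w')} | e w w'. e \<in> edges G \<and> {w, w'} \<in> edges H} \<union>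
     {{Inl u, Inr (e, w)} | u e w. e \<in> edges G \<and> u \<in> e \<and> w \<in> verts H})"

definition cycle_graph :: "nat \<Rightarrow> nat graph" where
  "cycle_graph m = ({0..<m}, {{i, Suc i mod m} | i. i < m})"

definition complete_graph :: "nat \<Rightarrow> nat graph" where
  "complete_graph n = ({0..<n}, {{a, b} | a b. a < n \<and> b < n \<and> a \<noteq> b})"

end

theory Submission
  imports Defs
begin

text \<open>Lower bounds. The vertices of one copy are twins, so they have different colours. Call a
  vertex full if all colours other than its own occur among its neighbours; two full vertices of the
  same colour have the same code. With \<open>n\<close> colours all vertices are full. With \<open>n + 1\<close> colours all cycle
  vertices are full, hence \<open>m \<le> n + 1\<close>. A rainbow path between two copies contains one of the two arcs
  of cycle vertices between them, which forces at least \<open>m / 2\<close> colours if \<open>m \<ge> 5\<close>.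

  Upper bounds. Colouring the cycle by residues modulo \<open>k\<close> makes one of two complementary arcs rainbow
  as soon as \<open>m \<le> 2 * k\<close>. The code of a vertex determines its colour and the set of colours at distance
  at least 2, and it suffices that this pair determines the vertex. In the copies it can be
  prescribed by the choice of the \<open>q = k - n\<close> missing colours. For \<open>q = 1\<close> one takes pairwise different
  colours, for \<open>q \<ge> 2\<close> cyclic windows of consecutive colours.\<close>

section \<open>Walks and distances to colour classes\<close>

lemma is_walk_Cons:
  assumes "xs \<noteq> []"
  shows "is_walk G (x # xs) \<longleftrightarrow> x \<in> verts G \<and> adj G x (hd xs) \<and> is_walk G xs"
proof
  assume W: "is_walk G (x # xs)"
  have "adj G (xs ! i) (xs ! Suc i)" if "Suc i < length xs" for i
    using W that unfolding is_walk_def by (auto dest: spec[of _ "Suc i"])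
  moreover have "adj G x (hd xs)"
    using W assms unfolding is_walk_def by (auto dest: spec[of _ 0] simp: hd_conv_nth)
  ultimately show "x \<in> verts G \<and> adj G x (hd xs) \<and> is_walk G xs"
    using W assms unfolding is_walk_def by auto
next
  assume W: "x \<in> verts G \<and> adj G x (hd xs) \<and> is_walk G xs"
  have "adj G ((x # xs) ! i) ((x # xs) ! Suc i)" if "Suc i < length (x # xs)" for i
    using W that assms unfolding is_walk_def by (cases i) (auto simp: hd_conv_nth)
  then show "is_walk G (x # xs)"
    using W unfolding is_walk_def by auto
qed

lemma is_walk_single: "is_walk G [x] \<longleftrightarrow> x \<in> verts G"
  by (simp add: is_walk_def)

lemma adj_commute: "adj G u v \<longleftrightarrow> adj G v u"
  by (auto simp: adj_def insert_commute)

lemma is_walk_append: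
  assumes "xs \<noteq> []" "ys \<noteq> []"
  shows "is_walk G (xs @ ys) \<longleftrightarrow> is_walk G xs \<and> is_walk G ys \<and> adj G (last xs) (hd ys)"
  using assms
proof (induction xs)
  case (Cons x xs)
  then show ?case
    by (cases "xs = []") (auto simp: is_walk_Cons is_walk_single)
qed simp

lemma is_walk_rev: "is_walk G xs \<Longrightarrow> is_walk G (rev xs)"
proof (induction xs)
  case (Cons x xs)
  then show ?case
    by (cases "xs = []")
       (auto simp: is_walk_Cons is_walk_single is_walk_append last_rev adj_commute)
qed simp

lemma is_walk_verts: "is_walk G xs \<Longrightarrow> x \<in> set xs \<Longrightarrow> x \<in> verts G"
  by (auto simp: is_walk_def)

lemma set_dist_le_walk:
  assumes "is_walk G xs" "hd xs = v" "last xs \<in> R"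
  shows "set_dist G v R \<le> enat (length xs - 1)"
proof -
  have "set_dist G v R \<le> gdist G v (last xs)"
    unfolding set_dist_def using assms(3) by (rule INF_lower)
  also have "\<dots> \<le> enat (length xs - 1)"
    unfolding gdist_def using assms by (intro Inf_lower) auto
  finally show ?thesis .
qed

text \<open>\<open>Inf\<close> of a nonempty set of \<open>enat\<close> is its least element, and
  \<open>Inf {}\<close> is infinite.\<close>

lemma enat_Inf_mem: "Inf A = enat d \<Longrightarrow> enat d \<in> (A :: enat set)"
  unfolding Inf_enat_def by (metis LeastI enat.distinct(1) ex_in_conv)

lemma set_dist_attained:
  assumes "set_dist G v R = enat d"
  obtains xs where "is_walk G xs" "hd xs = v" "last xs \<in> R" "length xs = Suc d"
proof -
  have "enat d \<in> gdist G v ` R"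
    using assms unfolding set_dist_def by (rule enat_Inf_mem)
  then obtain x where x: "x \<in> R" "gdist G v x = enat d" by auto
  have "enat d \<in> {enat (length xs - 1) | xs. is_walk G xs \<and> hd xs = v \<and> last xs = x}"
    using x(2) unfolding gdist_def by (rule enat_Inf_mem)
  then obtain xs where "d = length xs - 1" "is_walk G xs" "hd xs = v" "last xs = x" by auto
  moreover from this have "xs \<noteq> []" by (auto simp: is_walk_def)
  ultimately show thesis using that x(1) by auto
qed

lemma set_dist_eq_0_iff:
  assumes "v \<in> verts G"
  shows "set_dist G v R = 0 \<longleftrightarrow> v \<in> R"
proof
  assume "set_dist G v R = 0"
  then obtain xs where "is_walk G xs" "hd xs = v" "last xs \<in> R" "length xs = Suc 0"
    using set_dist_attained[of G v R 0] by (auto simp: zero_enat_def)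
  then show "v \<in> R" by (auto simp: length_Suc_conv)
next
  assume "v \<in> R"
  then have "set_dist G v R \<le> enat (length [v] - 1)"
    using assms by (intro set_dist_le_walk) (auto simp: is_walk_single)
  then show "set_dist G v R = 0" by (simp flip: zero_enat_def)
qed

lemma set_dist_adj_le:
  assumes "u \<in> verts G" "adj G u v"
  shows "set_dist G u R \<le> eSuc (set_dist G v R)"
proof (cases "set_dist G v R")
  case (enat d)
  then obtain xs where xs: "is_walk G xs" "hd xs = v" "last xs \<in> R" "length xs = Suc d"
    by (rule set_dist_attained)
  have ne: "xs \<noteq> []" using xs(4) by auto
  have "set_dist G u R \<le> enat (length (u # xs) - 1)"
    using assms xs ne by (intro set_dist_le_walk) (auto simp: is_walk_Cons)
  then show ?thesis using xs(4) enat by (simp add: eSuc_enat)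
qed simp

lemma set_dist_step:
  assumes "set_dist G v R = enat d" "v \<notin> R"
  obtains y where "y \<in> verts G" "adj G v y" "eSuc (set_dist G y R) \<le> enat d"
proof -
  obtain xs where xs: "is_walk G xs" "hd xs = v" "last xs \<in> R" "length xs = Suc d"
    using assms(1) by (rule set_dist_attained)
  obtain ys where ys: "xs = v # ys" using xs by (cases xs) auto
  have ne: "ys \<noteq> []" using xs(3) ys assms(2) by auto
  have W: "is_walk G ys" "adj G v (hd ys)"
    using xs(1) ys ne by (auto simp: is_walk_Cons)
  have "set_dist G (hd ys) R \<le> enat (length ys - 1)"
    using W ne xs(3) ys by (intro set_dist_le_walk) auto
  then have "eSuc (set_dist G (hd ys) R) \<le> eSuc (enat (length ys - 1))" by simp
  also have "\<dots> = enat d" using xs(4) ys ne by (cases ys) (auto simp: eSuc_enat)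
  finally show thesis
    using that[of "hd ys"] W ne is_walk_verts[OF W(1), of "hd ys"] by simp
qed

text \<open>A shortest walk from \<open>u\<close> to \<open>R\<close> has to leave \<open>u\<close>.
  Its second vertex is \<open>v\<close> or a neighbour of \<open>v\<close>, so starting at
  \<open>v\<close> is no longer. This compares twins, and copies with the ends of their
  edges.\<close>

lemma set_dist_mono_nbhd:
  assumes "v \<in> verts G" "u \<notin> R"
    and N: "\<And>y. y \<in> verts G \<Longrightarrow> adj G u y \<Longrightarrow> y = v \<or> adj G v y"
  shows "set_dist G v R \<le> set_dist G u R"
proof (cases "set_dist G u R")
  case (enat d)
  then obtain y where y: "y \<in> verts G" "adj G u y" "eSuc (set_dist G y R) \<le> enat d"
    using assms(2) by (rule set_dist_step)
  have "set_dist G v R \<le> eSuc (set_dist G y R)"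
    using N[OF y(1,2)] set_dist_adj_le[OF assms(1)] by (auto intro: order_trans[OF _ ile_eSuc])
  then show ?thesis using y(3) enat by simp
qed simp

lemma set_dist_le_1_iff:
  assumes "v \<in> verts G" "R \<subseteq> verts G"
  shows "set_dist G v R \<le> 1 \<longleftrightarrow> v \<in> R \<or> (\<exists>y\<in>R. adj G v y)"
proof
  assume le: "set_dist G v R \<le> 1"
  show "v \<in> R \<or> (\<exists>y\<in>R. adj G v y)"
  proof (cases "v \<in> R")
    case False
    obtain d where d: "set_dist G v R = enat d" using le by (cases "set_dist G v R") auto
    then obtain y where y: "y \<in> verts G" "adj G v y" "eSuc (set_dist G y R) \<le> enat d"
      using False by (rule set_dist_step)
    have "eSuc (set_dist G y R) \<le> eSuc 0"
      using y(3) le d by (metis one_eSuc order_trans)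
    then have "set_dist G y R = 0" by (simp only: eSuc_ile_mono le_zero_eq)
    then show ?thesis using y by (auto simp: set_dist_eq_0_iff)
  qed simp
next
  assume "v \<in> R \<or> (\<exists>y\<in>R. adj G v y)"
  then show "set_dist G v R \<le> 1"
  proof
    assume "v \<in> R"
    then have "set_dist G v R = 0" using set_dist_eq_0_iff[OF assms(1)] by blast
    then show ?thesis by simp
  next
    assume "\<exists>y\<in>R. adj G v y"
    then obtain y where y: "y \<in> R" "adj G v y" by auto
    have "set_dist G v R \<le> eSuc (set_dist G y R)" using assms(1) y(2) by (rule set_dist_adj_le)
    also have "set_dist G y R = 0" using y assms(2) by (auto simp: set_dist_eq_0_iff)
    finally show ?thesis by (simp add: one_eSuc)
  qed
qed

section \<open>Rainbow codes and the colours of closed neighbourhoods\<close>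

lemma rainbow_code_eq_iff:
  "rainbow_code G k c u = rainbow_code G k c v \<longleftrightarrow>
    (\<forall>i\<in>{1..k}. set_dist G u (color_class G c i) = set_dist G v (color_class G c i))"
  unfolding rainbow_code_def by auto

definition nbr_colors :: "'a graph \<Rightarrow> ('a \<Rightarrow> nat) \<Rightarrow> 'a \<Rightarrow> nat set" where
  "nbr_colors G c v = c ` {y \<in> verts G. adj G v y}"

lemma set_dist_color_class_eq_0_iff:
  "v \<in> verts G \<Longrightarrow> set_dist G v (color_class G c i) = 0 \<longleftrightarrow> c v = i"
  by (auto simp: set_dist_eq_0_iff color_class_def)

lemma set_dist_color_class_le_1_iff:
  "v \<in> verts G \<Longrightarrow>
    set_dist G v (color_class G c i) \<le> 1 \<longleftrightarrow> i \<in> insert (c v) (nbr_colors G c v)"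
  by (subst set_dist_le_1_iff) (auto simp: color_class_def nbr_colors_def)

text \<open>The entry 0 of a code marks the colour, and the entries at most 1 mark the colours in
  the closed neighbourhood.\<close>

lemma rainbow_code_eqD:
  assumes "rainbow_code G k c u = rainbow_code G k c v" "u \<in> verts G" "v \<in> verts G"
    and C: "\<And>x. x \<in> verts G \<Longrightarrow> c x \<in> {1..k}"
  shows "c u = c v" "insert (c u) (nbr_colors G c u) = insert (c v) (nbr_colors G c v)"
proof -
  have E: "set_dist G u (color_class G c i) = set_dist G v (color_class G c i)" if "i \<in> {1..k}" for i
    using assms(1) that by (simp add: rainbow_code_eq_iff)
  show "c u = c v"
    using E[OF C[OF assms(2)]] set_dist_color_class_eq_0_iff[OF assms(2)]
      set_dist_color_class_eq_0_iff[OF assms(3)] by metis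
  have S: "insert (c x) (nbr_colors G c x) \<subseteq> {1..k}" if "x \<in> verts G" for x
    using C that unfolding nbr_colors_def by blast
  show "insert (c u) (nbr_colors G c u) = insert (c v) (nbr_colors G c v)"
  proof (intro set_eqI iffI)
    fix i assume "i \<in> insert (c u) (nbr_colors G c u)"
    then show "i \<in> insert (c v) (nbr_colors G c v)"
      using S[OF assms(2)] E[of i] set_dist_color_class_le_1_iff[OF assms(2), of c i]
        set_dist_color_class_le_1_iff[OF assms(3), of c i] by (metis subsetD)
  next
    fix i assume "i \<in> insert (c v) (nbr_colors G c v)"
    then show "i \<in> insert (c u) (nbr_colors G c u)"
      using S[OF assms(3)] E[of i] set_dist_color_class_le_1_iff[OF assms(2), of c i]
        set_dist_color_class_le_1_iff[OF assms(3), of c i] by (metis subsetD)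
  qed
qed

text \<open>Once the colours agree, colours seen by both vertices give equal entries; distances
  matter only for colours that one of them does not see.\<close>

lemma rainbow_code_eqI:
  assumes "u \<in> verts G" "v \<in> verts G" "c u = c v"
    and "\<And>i. i \<in> {1..k} \<Longrightarrow>
      i \<in> insert (c u) (nbr_colors G c u) \<inter> insert (c v) (nbr_colors G c v) \<or>
      set_dist G u (color_class G c i) = set_dist G v (color_class G c i)"
  shows "rainbow_code G k c u = rainbow_code G k c v"
  unfolding rainbow_code_eq_iff
proof
  fix i assume i: "i \<in> {1..k}"
  let ?D = "\<lambda>x. set_dist G x (color_class G c i)"
  have D: "?D x = (if c x = i then 0 else 1)"
    if "x \<in> verts G" "i \<in> insert (c x) (nbr_colors G c x)" for x
  proof -
    have "?D x \<le> 1" using that by (simp add: set_dist_color_class_le_1_iff)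
    moreover have "?D x = 0 \<longleftrightarrow> c x = i" using that by (simp add: set_dist_color_class_eq_0_iff)
    ultimately show ?thesis
      by (metis dual_order.antisym ileI1 one_eSuc zero_less_iff_neq_zero)
  qed
  show "?D u = ?D v" using assms(4)[OF i] D[of u] D[of v] assms(1-3) by auto
qed

lemma rainbow_code_eq_twins:
  assumes "u \<in> verts G" "v \<in> verts G" "c u = c v"
    and "\<And>y. y \<in> verts G \<Longrightarrow> adj G u y \<Longrightarrow> y = v \<or> adj G v y"
    and "\<And>y. y \<in> verts G \<Longrightarrow> adj G v y \<Longrightarrow> y = u \<or> adj G u y"
  shows "rainbow_code G k c u = rainbow_code G k c v"
  unfolding rainbow_code_eq_iff
proof
  fix i assume i: "i \<in> {1..k}"
  let ?R = "color_class G c i"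
  show "set_dist G u ?R = set_dist G v ?R"
  proof (cases "c u = i")
    case True
    then show ?thesis using assms(1-3) set_dist_color_class_eq_0_iff by metis
  next
    case False
    then have "u \<notin> ?R" "v \<notin> ?R" using assms(3) by (auto simp: color_class_def)
    then show ?thesis using assms by (intro antisym set_dist_mono_nbhd) auto
  qed
qed

section \<open>Edge coronas of cycles with complete graphs\<close>

locale cycle_corona =
  fixes m n :: nat
  assumes m3: "m \<ge> 3" and n1: "n \<ge> 1"
begin

definition nxt :: "nat \<Rightarrow> nat" where "nxt x = (if Suc x = m then 0 else Suc x)"
definition prv :: "nat \<Rightarrow> nat" where "prv x = (if x = 0 then m - 1 else x - 1)"

abbreviation G where "G \<equiv> edge_corona (cycle_graph m) (complete_graph n)"
text \<open>Naming an edge by its first end turns the copies into indices below \<open>m\<close>;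
  the cycle vertex \<open>x\<close> meets the copies \<open>x\<close> and
  \<open>prv x\<close>.\<close>

definition X :: "nat \<Rightarrow> nat \<Rightarrow> nat + nat set \<times> nat" where
  "X i w = Inr ({i, nxt i}, w)"

lemma nxt_mod: "x < m \<Longrightarrow> Suc x mod m = nxt x"
  by (auto simp: nxt_def)

lemma nxt_prv_simps [simp]:
  assumes "x < m"
  shows "nxt x < m" "prv x < m" "nxt (prv x) = x" "prv (nxt x) = x" "nxt x \<noteq> x" "prv x \<noteq> x"
    "nxt x \<noteq> prv x" "x \<noteq> nxt x" "x \<noteq> prv x" "prv x \<noteq> nxt x"
    "nxt (nxt x) \<noteq> x"
  using assms m3 by (auto simp: nxt_def prv_def)

text \<open>For \<open>m = 2\<close> the indices 0 and 1 would name the same edge; \<open>m3\<close>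
  excludes this.\<close>

lemma cycle_edge_eq_iff [simp]:
  "i < m \<Longrightarrow> j < m \<Longrightarrow> {i, nxt i} = {j, nxt j} \<longleftrightarrow> i = j"
  using m3 by (auto simp: doubleton_eq_iff nxt_def split: if_splits)

lemma prv_eq_prv_iff [simp]: "x < m \<Longrightarrow> y < m \<Longrightarrow> prv x = prv y \<longleftrightarrow> x = y"
  by (metis nxt_prv_simps(3))

lemma X_simps [simp]:
  "X i w \<noteq> Inl x" "Inl x \<noteq> X i w"
  "i < m \<Longrightarrow> j < m \<Longrightarrow> X i w = X j w' \<longleftrightarrow> i = j \<and> w = w'"
  by (auto simp: X_def)

lemma nxt_eq_iff: "u < m \<Longrightarrow> v < m \<Longrightarrow> nxt u = v \<longleftrightarrow> u = prv v"
  by auto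

lemma edges_cycle: "edges (cycle_graph m) = (\<lambda>i. {i, nxt i}) ` {..<m}"
  unfolding edges_def cycle_graph_def by (auto simp: nxt_mod)

lemma verts_G: "verts G = Inl ` {..<m} \<union> {X i w | i w. i < m \<and> w < n}"
  unfolding edge_corona_def verts_def edges_cycle
  by (auto simp: verts_def cycle_graph_def complete_graph_def X_def)

lemma Inl_verts [simp]: "Inl x \<in> verts G \<longleftrightarrow> x < m"
  by (auto simp: verts_G)

lemma X_verts: "i < m \<Longrightarrow> w < n \<Longrightarrow> X i w \<in> verts G"
  by (auto simp: verts_G)

lemma verts_cases [consumes 1, case_names cycle copy]:
  assumes "v \<in> verts G"
  obtains x where "x < m" "v = Inl x" | i w where "i < m" "w < n" "v = X i w"
  using assms by (auto simp: verts_G)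

lemma edges_G: "edges G = {{Inl u, Inl v} | u v. {u, v} \<in> edges (cycle_graph m)} \<union>
     {{Inr (e, w), Inr (e, w')} | e w w'. e \<in> edges (cycle_graph m) \<and> {w, w'} \<in> edges (complete_graph n)} \<union>
     {{Inl u, Inr (e, w)} | u e w. e \<in> edges (cycle_graph m) \<and> u \<in> e \<and> w \<in> verts (complete_graph n)}"
  unfolding edge_corona_def edges_def by simp

lemma mem_edges_cycle:
  assumes "u < m" "v < m"
  shows "{u, v} \<in> edges (cycle_graph m) \<longleftrightarrow> v = nxt u \<or> v = prv u"
proof -
  have "{u, v} \<in> edges (cycle_graph m) \<longleftrightarrow> (\<exists>i<m. u = i \<and> v = nxt i \<or> v = i \<and> u = nxt i)"
    by (auto simp: edges_cycle doubleton_eq_iff)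
  also have "\<dots> \<longleftrightarrow> v = nxt u \<or> v = prv u"
    using assms nxt_eq_iff[of v u] by auto
  finally show ?thesis .
qed

lemma adj_Inl_Inl:
  assumes "u < m" "v < m"
  shows "adj G (Inl u) (Inl v) \<longleftrightarrow> v = nxt u \<or> v = prv u"
proof -
  have "{Inl u, Inl v} \<in> edges G \<longleftrightarrow> {u, v} \<in> edges (cycle_graph m)"
    unfolding edges_G by (auto simp: doubleton_eq_iff insert_commute)
  then show ?thesis
    using assms mem_edges_cycle[OF assms] by (auto simp: adj_def)
qed

lemma adj_Inl_X:
  "u < m \<Longrightarrow> i < m \<Longrightarrow> w < n \<Longrightarrow> adj G (Inl u) (X i w) \<longleftrightarrow> i = u \<or> i = prv u"
  unfolding adj_def edges_G edges_cycle X_def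
  by (auto simp: doubleton_eq_iff verts_def complete_graph_def)

lemma adj_X_Inl:
  "u < m \<Longrightarrow> i < m \<Longrightarrow> w < n \<Longrightarrow> adj G (X i w) (Inl u) \<longleftrightarrow> i = u \<or> i = prv u"
  by (subst adj_commute) (rule adj_Inl_X)

lemma adj_X_X:
  assumes "i < m" "j < m" "w < n" "w' < n"
  shows "adj G (X i w) (X j w') \<longleftrightarrow> i = j \<and> w \<noteq> w'"
proof -
  have "{X i w, X j w'} \<in> edges G \<longleftrightarrow>
      {i, nxt i} = {j, nxt j} \<and> {w, w'} \<in> edges (complete_graph n)"
    unfolding edges_G X_def using assms
    by (auto simp: doubleton_eq_iff[of "Inr _"] doubleton_eq_iff[of "Inl _"] insert_commute edges_cycle
        simp del: cycle_edge_eq_iff)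
  also have "\<dots> \<longleftrightarrow> i = j \<and> w \<noteq> w'"
    using assms by (auto simp: edges_def complete_graph_def doubleton_eq_iff)
  finally show ?thesis using assms by (auto simp: adj_def)
qed

lemmas adj_G = adj_Inl_Inl adj_Inl_X adj_X_Inl adj_X_X

definition copy_colors :: "(nat + nat set \<times> nat \<Rightarrow> nat) \<Rightarrow> nat \<Rightarrow> nat set" where
  "copy_colors c i = (\<lambda>w. c (X i w)) ` {..<n}"

lemma nbr_colors_cycle:
  assumes "x < m"
  shows "nbr_colors G c (Inl x) =
    {c (Inl (nxt x)), c (Inl (prv x))} \<union> copy_colors c x \<union> copy_colors c (prv x)" (is "?L = ?R")
proof
  show "?L \<subseteq> ?R"
  proof
    fix a assume "a \<in> ?L"
    then obtain y where y: "y \<in> verts G" "adj G (Inl x) y" "a = c y"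
      unfolding nbr_colors_def by auto
    from y(1) show "a \<in> ?R"
      by (cases rule: verts_cases) (use y assms in \<open>auto simp: adj_G copy_colors_def\<close>)
  qed
  have "c (Inl z) \<in> ?L" if "z = nxt x \<or> z = prv x" for z
    unfolding nbr_colors_def using assms that by (intro imageI) (auto simp: adj_G)
  moreover have "c (X z w) \<in> ?L" if "z = x \<or> z = prv x" "w < n" for z w
    unfolding nbr_colors_def using assms that by (intro imageI) (auto simp: adj_G X_verts)
  ultimately show "?R \<subseteq> ?L" unfolding copy_colors_def by blast
qed

lemma nbr_colors_copy:
  assumes "i < m" "w < n"
  shows "insert (c (X i w)) (nbr_colors G c (X i w)) =
    {c (Inl i), c (Inl (nxt i))} \<union> copy_colors c i" (is "?L = ?R")
proof
  show "?L \<subseteq> ?R"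
  proof
    fix a assume "a \<in> ?L"
    then consider "a = c (X i w)" | y where "y \<in> verts G" "adj G (X i w) y" "a = c y"
      unfolding nbr_colors_def by auto
    then show "a \<in> ?R"
    proof cases
      case 2
      from this(1) show ?thesis
        by (cases rule: verts_cases) (use 2 assms in \<open>auto simp: adj_G copy_colors_def\<close>)
    qed (use assms in \<open>auto simp: copy_colors_def\<close>)
  qed
  have "c (Inl z) \<in> nbr_colors G c (X i w)" if "z = i \<or> z = nxt i" for z
    unfolding nbr_colors_def using assms that by (intro imageI) (auto simp: adj_G)
  moreover have "c (X i w') \<in> ?L" if "w' < n" for w'
    using assms that unfolding nbr_colors_def
    by (cases "w' = w") (auto simp: adj_G X_verts intro!: imageI)
  ultimately show "?R \<subseteq> ?L" unfolding copy_colors_def by blast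
qed

end

section \<open>Lower bounds from full vertices\<close>

locale located_cycle_corona = cycle_corona +
  fixes k :: nat and c :: "nat + nat set \<times> nat \<Rightarrow> nat"
  assumes lrc: "locating_rainbow_coloring G k c"
begin

lemma color_range: "v \<in> verts G \<Longrightarrow> c v \<in> {1..k}"
  using lrc by (auto simp: locating_rainbow_coloring_def rainbow_vertex_coloring_def)

lemma code_inj: "u \<in> verts G \<Longrightarrow> v \<in> verts G \<Longrightarrow> rainbow_code G k c u = rainbow_code G k c v \<Longrightarrow> u = v"
  using lrc by (auto simp: locating_rainbow_coloring_def inj_on_def)

lemma copy_colors_subset: "i < m \<Longrightarrow> copy_colors c i \<subseteq> {1..k}"
  using color_range by (auto simp: copy_colors_def X_verts simp del: atLeastAtMost_iff)

lemma card_copy_colors: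
  assumes "i < m"
  shows "card (copy_colors c i) = n"
proof -
  have "inj_on (\<lambda>w. c (X i w)) {..<n}"
  proof (rule inj_onI, rule ccontr)
    fix w w' assume w: "w \<in> {..<n}" "w' \<in> {..<n}" "c (X i w) = c (X i w')" "w \<noteq> w'"
    have T: "y = X i b \<or> adj G (X i b) y"
      if "y \<in> verts G" "adj G (X i a) y" "a < n" "b < n" for a b y
      using that(1) by (cases rule: verts_cases) (use that assms in \<open>auto simp: adj_G\<close>)
    have "rainbow_code G k c (X i w) = rainbow_code G k c (X i w')"
      using w assms by (intro rainbow_code_eq_twins X_verts T[of _ w w'] T[of _ w' w]) auto
    then have "X i w = X i w'" using w assms by (intro code_inj X_verts) auto
    then show False using w assms by simp
  qed
  then show ?thesis by (simp add: copy_colors_def card_image)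
qed

text \<open>All neighbours of a vertex in a copy are ends of its edge or lie in the same copy, hence
  are equal or adjacent to each end.\<close>

lemma set_dist_cycle_le_copy:
  assumes "x < m" "i = x \<or> i = prv x" "w < n" "X i w \<notin> R"
  shows "set_dist G (Inl x) R \<le> set_dist G (X i w) R"
proof (rule set_dist_mono_nbhd)
  fix y assume y: "y \<in> verts G" "adj G (X i w) y"
  from y(1) show "y = Inl x \<or> adj G (Inl x) y"
    by (cases rule: verts_cases) (use y assms in \<open>auto simp: adj_G\<close>)
qed (use assms in auto)

text \<open>If a cycle vertex \<open>x\<close> sees no vertex of colour \<open>a\<close>, both copies at \<open>x\<close> use exactly the colours
  other than \<open>a\<close>. A nearest vertex of colour \<open>a\<close> is reached from \<open>x\<close> through a neighbour on the cycle,
  and the copy on that side contains a vertex with the same code as \<open>x\<close>.\<close>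

lemma cycle_vertex_full:
  assumes k: "k \<le> n + 1" and x: "x < m"
  shows "{1..k} \<subseteq> insert (c (Inl x)) (nbr_colors G c (Inl x))"
proof (rule ccontr)
  assume "\<not> ?thesis"
  then obtain a where a: "a \<in> {1..k}" "a \<noteq> c (Inl x)" "a \<notin> nbr_colors G c (Inl x)"
    unfolding subset_iff by blast
  let ?R = "color_class G c a" and ?I = "{x, prv x}"
  have CC: "copy_colors c i = {1..k} - {a}" if "i \<in> ?I" for i
  proof (rule card_subset_eq)
    have i: "i < m" using that x by auto
    show sub: "copy_colors c i \<subseteq> {1..k} - {a}"
      using copy_colors_subset[OF i] a(3) that x by (auto simp: nbr_colors_cycle)
    have "card (copy_colors c i) \<le> card ({1..k} - {a})" by (rule card_mono[OF _ sub]) simp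
    then show "card (copy_colors c i) = card ({1..k} - {a})"
      using card_copy_colors[OF i] k a(1) by simp
  qed simp
  have notR: "X i w \<notin> ?R" if "i \<in> ?I" "w < n" for i w
    using CC[OF that(1)] that(2) by (auto simp: color_class_def copy_colors_def)
  have ex: "\<exists>w<n. c (X i w) = c (Inl x)" if "i \<in> ?I" for i
  proof -
    have "c (Inl x) \<in> copy_colors c i" using CC[OF that] color_range[of "Inl x"] x a(2) by simp
    then show ?thesis by (auto simp: copy_colors_def)
  qed
  have le: "set_dist G (Inl x) ?R \<le> set_dist G (X i w) ?R" if "i \<in> ?I" "w < n" for i w
    using that x notR by (intro set_dist_cycle_le_copy) auto
  have "\<exists>i\<in>?I. \<forall>w<n. set_dist G (X i w) ?R = set_dist G (Inl x) ?R"
  proof (cases "set_dist G (Inl x) ?R")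
    case infinity
    then show ?thesis using le[of x] by auto
  next
    case (enat d)
    have "Inl x \<notin> ?R" using a(2) by (auto simp: color_class_def)
    with enat obtain y where y: "y \<in> verts G" "adj G (Inl x) y" "eSuc (set_dist G y ?R) \<le> enat d"
      by (rule set_dist_step)
    from y(1) show ?thesis
    proof (cases rule: verts_cases)
      case (cycle z)
      then have z: "z = nxt x \<or> z = prv x" using y(2) x by (simp add: adj_G)
      define i where "i = (if z = nxt x then x else prv x)"
      have i: "i \<in> ?I" "i < m" using x by (auto simp: i_def)
      have "set_dist G (X i w) ?R \<le> set_dist G (Inl x) ?R" if "w < n" for w
      proof -
        have "adj G (X i w) y" using cycle z x that by (auto simp: adj_G i_def)
        then have "set_dist G (X i w) ?R \<le> eSuc (set_dist G y ?R)"
          using that i(2) by (intro set_dist_adj_le X_verts)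
        then show ?thesis using y(3) enat by simp
      qed
      then show ?thesis using le i(1) by (meson antisym)
    next
      case (copy i w)
      then have i: "i \<in> ?I" using y(2) x by (auto simp: adj_G)
      \<comment> \<open>By \<open>le\<close> the copy vertex \<open>y\<close> is at least as far
        from colour \<open>a\<close> as \<open>x\<close> is, although \<open>y\<close> was chosen
        closer.\<close>
      have "eSuc (set_dist G y ?R) \<le> set_dist G y ?R"
        using le[OF i copy(2)] y(3) enat copy(3) by auto
      moreover have "set_dist G y ?R \<noteq> \<infinity>" using y(3) by (cases "set_dist G y ?R") auto
      ultimately show ?thesis by (cases "set_dist G y ?R") (auto simp: eSuc_enat)
    qed
  qed
  then obtain i where i: "i \<in> ?I" "\<And>w. w < n \<Longrightarrow> set_dist G (X i w) ?R = set_dist G (Inl x) ?R"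
    by auto
  obtain w where w: "w < n" "c (X i w) = c (Inl x)" using ex[OF i(1)] by auto
  have im: "i < m" using i(1) x by auto
  have "rainbow_code G k c (X i w) = rainbow_code G k c (Inl x)"
  proof (rule rainbow_code_eqI)
    fix b assume b: "b \<in> {1..k}"
    show "b \<in> insert (c (X i w)) (nbr_colors G c (X i w)) \<inter> insert (c (Inl x)) (nbr_colors G c (Inl x))
      \<or> set_dist G (X i w) (color_class G c b) = set_dist G (Inl x) (color_class G c b)"
    proof (cases "b = a")
      case True
      then show ?thesis using i(2) w by simp
    next
      case False
      then have "b \<in> copy_colors c i" using CC[OF i(1)] b by simp
      then show ?thesis using i(1) x by (auto simp: nbr_colors_cycle nbr_colors_copy[OF im w(1)])
    qed
  qed (use x im w in \<open>auto simp: X_verts\<close>)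
  then have "X i w = Inl x" using x im w by (intro code_inj X_verts) auto
  then show False by simp
qed

lemma n_lt_k: "n < k"
proof (rule ccontr)
  assume "\<not> n < k"
  have m0: "0 < m" using m3 by simp
  have CC: "copy_colors c 0 = {1..k}"
    using card_copy_colors[OF m0] copy_colors_subset[OF m0] card_mono[OF _ copy_colors_subset[OF m0]]
      \<open>\<not> n < k\<close> by (intro card_subset_eq) auto
  then have "c (Inl 0) \<in> copy_colors c 0" using color_range[of "Inl 0"] m0 by simp
  then obtain w where w: "w < n" "c (X 0 w) = c (Inl 0)" by (auto simp: copy_colors_def)
  have "rainbow_code G k c (X 0 w) = rainbow_code G k c (Inl 0)"
    using w m0 CC nbr_colors_copy[OF m0 w(1), of c] nbr_colors_cycle[OF m0, of c]
    by (intro rainbow_code_eqI X_verts) auto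
  then have "X 0 w = Inl 0" using m0 w by (intro code_inj X_verts) auto
  then show False by simp
qed

lemma m_le_k_if_few_colors:
  assumes "k \<le> n + 1"
  shows "m \<le> k"
proof -
  have "inj_on (\<lambda>x. c (Inl x)) {..<m}"
  proof (rule inj_onI)
    fix x y assume xy: "x \<in> {..<m}" "y \<in> {..<m}" "c (Inl x) = c (Inl y)"
    have "rainbow_code G k c (Inl x) = rainbow_code G k c (Inl y)"
      using xy cycle_vertex_full[OF assms, of x] cycle_vertex_full[OF assms, of y]
      by (intro rainbow_code_eqI) auto
    then have "(Inl x :: nat + nat set \<times> nat) = Inl y" using xy by (intro code_inj) auto
    then show "x = y" by simp
  qed
  then have "card {..<m} \<le> card {1..k}"
    by (rule card_inj_on_le) (use color_range in \<open>auto simp del: atLeastAtMost_iff\<close>)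
  then show ?thesis by simp
qed

end

section \<open>Arcs between two copies\<close>

context cycle_corona
begin

text \<open>For \<open>x < y < m\<close>, one of the two sides into which deleting
  \<open>Inl x\<close> and \<open>Inl y\<close> divides the corona. The bounds on \<open>i\<close>
  differ from those on \<open>v\<close> because copy \<open>i\<close> sits on the edge from
  \<open>i\<close> to \<open>Suc i\<close>.\<close>

definition between :: "nat \<Rightarrow> nat \<Rightarrow> nat + nat set \<times> nat \<Rightarrow> bool" where
  "between x y p \<longleftrightarrow> (\<exists>v. p = Inl v \<and> x < v \<and> v < y) \<or> (\<exists>i w. p = X i w \<and> x \<le> i \<and> i < y)"

lemma between_adj:
  assumes "y < m" "between x y p" "p \<in> verts G" "q \<in> verts G" "adj G p q"
    "q \<noteq> Inl x" "q \<noteq> Inl y"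
  shows "between x y q"
proof -
  have nxt: "nxt i = Suc i" if "i < y" for i using that assms(1) by (simp add: nxt_def)
  have prv: "prv i = i - 1" if "x < i" for i using that by (simp add: prv_def)
  from assms(3) show ?thesis
  proof (cases rule: verts_cases)
    case p: (cycle u)
    then have u: "x < u" "u < y" using assms(2) by (auto simp: between_def)
    from assms(4) show ?thesis
    proof (cases rule: verts_cases)
      case (cycle v)
      then have "v = Suc u \<or> v = u - 1" using assms(5) p u nxt prv by (auto simp: adj_G)
      then have "x < v \<and> v < y" using u assms(6,7) cycle(2) by (cases "v = x"; cases "v = y") auto
      then show ?thesis using cycle by (simp add: between_def)
    next
      case (copy i w)
      then have "i = u \<or> i = u - 1" using assms(5) p u prv by (auto simp: adj_G)
      then show ?thesis using u copy unfolding between_def by auto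
    qed
  next
    case p: (copy i w)
    then have i: "x \<le> i" "i < y" using assms(1,2) by (auto simp: between_def)
    from assms(4) show ?thesis
    proof (cases rule: verts_cases)
      case (cycle v)
      then have "v = i \<or> v = Suc i" using assms(5) p i nxt nxt_eq_iff[of i v] by (auto simp: adj_G)
      then have "x < v \<and> v < y" using i assms(6,7) cycle(2) by (cases "v = x"; cases "v = y") auto
      then show ?thesis using cycle by (simp add: between_def)
    next
      case (copy j w')
      then show ?thesis using assms(5) p i by (auto simp: adj_G between_def)
    qed
  qed
qed

lemma walk_separated:
  assumes "is_walk G xs" "y < m" "between x y (hd xs)" "\<not> between x y (last xs)"
  shows "Inl x \<in> set xs \<or> Inl y \<in> set xs"
  using assms
proof (induction xs)
  case (Cons p xs)
  show ?case
  proof (cases "xs = []")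
    case False
    then have W: "p \<in> verts G" "adj G p (hd xs)" "is_walk G xs"
      using Cons.prems(1) by (auto simp: is_walk_Cons)
    have "hd xs \<in> verts G" using W(3) False by (auto intro: is_walk_verts)
    then have "hd xs = Inl x \<or> hd xs = Inl y \<or> between x y (hd xs)"
      using between_adj[of y x p "hd xs"] Cons.prems W by auto
    moreover have "hd xs \<in> set xs" using False by simp
    ultimately show ?thesis using Cons False W by (metis last_ConsR list.set_intros(2))
  qed (use Cons in auto)
qed (simp add: is_walk_def)

text \<open>Copies \<open>i\<close> and \<open>j\<close> split the cycle into the arc
  \<open>{i<..j}\<close> and its complement. Deleting one vertex of each arc separates the copies,
  so a walk that misses a vertex of one arc contains all of the other.\<close>

lemma walk_hits_arc_cut:
  assumes "is_walk G xs" "hd xs = X i w" "last xs = X j w'" "i < m" "j < m"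
    and "x \<in> {i<..j}" "y \<in> {..<m} - {i<..j}"
  shows "Inl x \<in> set xs \<or> Inl y \<in> set xs"
proof (cases "y \<le> i")
  case True
  then have "between y x (hd xs)" "\<not> between y x (last xs)"
    using assms by (auto simp: between_def)
  then show ?thesis using walk_separated[of xs x y] assms by auto
next
  case False
  \<comment> \<open>Here \<open>y > j\<close>, so the end of the walk, not its start, lies between
    \<open>x\<close> and \<open>y\<close>.\<close>
  have W: "is_walk G (rev xs)" using assms(1) by (rule is_walk_rev)
  have "xs \<noteq> []" using assms(1) by (simp add: is_walk_def)
  then have "between x y (hd (rev xs))" "\<not> between x y (last (rev xs))"
    using assms False by (auto simp: between_def hd_rev last_rev)
  then show ?thesis using walk_separated[OF W, of y x] assms by auto
qed

end

lemma set_internal: "x \<in> set xs \<Longrightarrow> x \<noteq> hd xs \<Longrightarrow> x \<noteq> last xs \<Longrightarrow> x \<in> set (internal xs)"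
  by (cases xs; cases "tl xs" rule: rev_cases) (auto simp: internal_def)

section \<open>Lower bound from rainbow arcs\<close>

context located_cycle_corona
begin

text \<open>A rainbow path between the copies has its ends off the cycle, so the arc it contains
  consists of internal vertices.\<close>

lemma arc_inj:
  assumes "i < j" "j < m"
  shows "inj_on (\<lambda>x. c (Inl x)) {i<..j} \<or> inj_on (\<lambda>x. c (Inl x)) ({..<m} - {i<..j})"
proof -
  have ij: "i < m" "0 < n" using assms n1 by auto
  have "X i 0 \<in> verts G" "X j 0 \<in> verts G" "X i 0 \<noteq> X j 0" using assms ij by (auto simp: X_verts)
  then obtain xs where xs: "is_path G xs" "hd xs = X i 0" "last xs = X j 0"
      "distinct (map c (internal xs))"
    using lrc unfolding locating_rainbow_coloring_def rainbow_vertex_coloring_def by meson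
  have "inj_on (\<lambda>x. c (Inl x)) A" if "Inl ` A \<subseteq> set xs" for A
  proof -
    have "Inl ` A \<subseteq> set (internal xs)"
      using that xs by (intro subsetI set_internal) auto
    moreover have "inj_on c (set (internal xs))" using xs(4) by (simp add: distinct_map)
    ultimately have "inj_on c (Inl ` A)" by (rule inj_on_subset[rotated])
    then have "inj_on (c \<circ> Inl) A" by (intro comp_inj_on) auto
    then show ?thesis by (simp add: comp_def)
  qed
  moreover have "Inl x \<in> set xs \<or> Inl y \<in> set xs" if "x \<in> {i<..j}" "y \<in> {..<m} - {i<..j}" for x y
    using walk_hits_arc_cut[OF _ xs(2,3) ij(1) assms(2) that] xs(1) by (auto simp: is_path_def)
  ultimately show ?thesis by (cases "\<forall>x\<in>{i<..j}. Inl x \<in> set xs") blast+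
qed

lemma inj_colors_card_le:
  assumes "inj_on (\<lambda>x. c (Inl x)) A" "A \<subseteq> {..<m}"
  shows "card A \<le> k"
proof -
  have "(\<lambda>x. c (Inl x)) ` A \<subseteq> {1..k}"
    using color_range assms(2) by (auto simp del: atLeastAtMost_iff)
  then have "card A \<le> card {1..k}" using assms(1) by (intro card_inj_on_le) auto
  then show ?thesis by simp
qed

lemma inj_colors_image:
  assumes "inj_on (\<lambda>x. c (Inl x)) A" "A \<subseteq> {..<m}" "card A = k"
  shows "(\<lambda>x. c (Inl x)) ` A = {1..k}"
proof (rule card_subset_eq)
  show "(\<lambda>x. c (Inl x)) ` A \<subseteq> {1..k}"
    using color_range assms(2) by (auto simp del: atLeastAtMost_iff)
qed (use assms in \<open>auto simp: card_image\<close>)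

text \<open>The complementary arc has more than \<open>k\<close> vertices and cannot have distinct
  colours.\<close>

lemma arc_window:
  assumes "i < j" "j < m" "m - (j - i) > k"
  shows "inj_on (\<lambda>x. c (Inl x)) {i<..j}"
proof -
  have "{i<..j} \<subseteq> {..<m}" using assms by auto
  then have "card ({..<m} - {i<..j}) = m - (j - i)" by (subst card_Diff_subset) auto
  then show ?thesis using arc_inj[OF assms(1,2)] inj_colors_card_le assms(3)
    by (metis Diff_subset leD)
qed

lemma coarc_window:
  assumes "i < j" "j < m" "j - i > k"
  shows "inj_on (\<lambda>x. c (Inl x)) ({..<m} - {i<..j})"
proof -
  have "{i<..j} \<subseteq> {..<m}" using assms by auto
  then show ?thesis using arc_inj[OF assms(1,2)] inj_colors_card_le[of "{i<..j}"] assms(3) by auto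
qed

text \<open>If \<open>m = 2 * k + 1\<close>, every \<open>k\<close> consecutive cycle vertices carry all \<open>k\<close> colours, so the
  colours have period \<open>k\<close> around the cycle. Then the vertices \<open>0\<close> and \<open>2 * k\<close>, which lie in a common
  window, have the same colour.\<close>

lemma m_le_twice_k:
  assumes m5: "m \<ge> 5"
  shows "m \<le> 2 * k"
proof (rule ccontr)
  assume "\<not> ?thesis"
  then have lt: "2 * k < m" by simp
  let ?f = "\<lambda>x. c (Inl x)"
  show False
  proof (cases "m = 2 * k + 1")
    case False
    \<comment> \<open>For \<open>m > 2 * k + 1\<close> both this arc and its complement have more
      than \<open>k\<close> vertices.\<close>
    then have "inj_on ?f {0<..k + 1}" using lt m5 by (intro arc_window) auto
    moreover have "k + 1 < m" using lt False by linarith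
    then have "{0<..k + 1} \<subseteq> {..<m}" by auto
    ultimately show False using inj_colors_card_le[of "{0<..k + 1}"] by simp
  next
    case m: True
    have k2: "k \<ge> 2" using m m5 by simp
    \<comment> \<open>Sliding a window by one vertex: \<open>A\<close> carries all colours and
      \<open>B\<close> keeps all of \<open>A\<close> but \<open>x\<close>, so the entering
      \<open>y\<close> takes over the colour of \<open>x\<close>.\<close>
    have shift: "?f y = ?f x"
      if "inj_on ?f A" "inj_on ?f B" "A \<subseteq> {..<m}" "card A = k" "A - {x} \<subseteq> B" "y \<in> B" "y \<notin> A" "y < m"
      for A B x y
    proof -
      have "?f y \<in> ?f ` A" using inj_colors_image[OF that(1,3,4)] color_range[of "Inl y"] that(8) by simp
      then obtain a where a: "a \<in> A" "?f y = ?f a" by auto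
      have "a = x"
      proof (rule ccontr)
        assume "a \<noteq> x"
        then have "a \<in> B" using a that by auto
        then show False using inj_onD[OF that(2) a(2)] that a by auto
      qed
      then show ?thesis using a by simp
    qed
    \<comment> \<open>No arc \<open>{i<..j}\<close> contains 0, so windows through 0 arise as
      complements.\<close>
    have co: "{..<m} - {k - 1<..2 * k} = {..<k}" using m k2 by auto
    have "inj_on ?f {..<k}" using coarc_window[of "k - 1" "2 * k"] co m k2 by simp
    moreover have "inj_on ?f {0<..k}" using m k2 by (intro arc_window) auto
    ultimately have 1: "?f k = ?f 0" by (rule shift) (use m k2 in auto)
    have "inj_on ?f {k - 1<..2 * k - 1}" using m k2 by (intro arc_window) auto
    moreover have "inj_on ?f {k<..2 * k}" using m k2 by (intro arc_window) auto
    ultimately have 2: "?f (2 * k) = ?f k" by (rule shift) (use m k2 in auto)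
    \<comment> \<open>This window is \<open>{..<k - 1}\<close> together with \<open>2 * k\<close>,
      so it contains both \<open>0\<close> and \<open>2 * k\<close>.\<close>
    have "inj_on ?f ({..<m} - {k - 2<..2 * k - 1})" using m k2 by (intro coarc_window) auto
    then have "2 * k = 0" by (rule inj_onD) (use 1 2 m k2 in auto)
    then show False using k2 by simp
  qed
qed

end

section \<open>Rainbow colourings from residues\<close>

definition rainbow_path :: "'a graph \<Rightarrow> ('a \<Rightarrow> nat) \<Rightarrow> 'a \<Rightarrow> 'a \<Rightarrow> bool" where
  "rainbow_path G c u v \<longleftrightarrow>
    (\<exists>xs. is_path G xs \<and> hd xs = u \<and> last xs = v \<and> distinct (map c (internal xs)))"

lemma rainbow_path_sym:
  assumes "rainbow_path G c u v"
  shows "rainbow_path G c v u"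
proof -
  obtain xs where xs: "is_path G xs" "hd xs = u" "last xs = v" "distinct (map c (internal xs))"
    using assms by (auto simp: rainbow_path_def)
  have "internal (rev xs) = rev (internal xs)"
    unfolding internal_def by (metis butlast_rev butlast_tl rev_rev_ident)
  then have "distinct (map c (internal (rev xs)))" using xs(4) by (simp add: rev_map[symmetric])
  moreover have "is_path G (rev xs)" using xs(1) by (simp add: is_path_def is_walk_rev)
  moreover have "xs \<noteq> []" using xs(1) by (auto simp: is_path_def is_walk_def)
  ultimately show ?thesis using xs unfolding rainbow_path_def
    by (intro exI[of _ "rev xs"]) (auto simp: hd_rev last_rev)
qed

lemma rainbow_path_adj:
  "u \<in> verts G \<Longrightarrow> v \<in> verts G \<Longrightarrow> adj G u v \<Longrightarrow> rainbow_path G c u v"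
  unfolding rainbow_path_def
  by (rule exI[of _ "[u, v]"])
    (auto simp: is_path_def is_walk_Cons is_walk_single internal_def adj_def)

text \<open>A cycle vertex as target is the last vertex of an arc, a copy vertex is attached to it;
  the alternatives for \<open>b\<close> cover both.\<close>

lemma rainbow_path_through:
  assumes "is_walk G zs" "distinct (map c zs)"
    and "a \<in> verts G" "adj G a (hd zs)" "a \<notin> set zs"
    and "b \<in> verts G" "b = last zs \<or> adj G (last zs) b \<and> b \<notin> set zs" "a \<noteq> b"
  shows "rainbow_path G c a b"
proof -
  have ne: "zs \<noteq> []" using assms(1) by (simp add: is_walk_def)
  have d: "distinct zs" using assms(2) by (simp add: distinct_map)
  have W: "is_walk G (a # zs)" using assms ne by (simp add: is_walk_Cons)
  from assms(7) show ?thesis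
  proof
    assume "b = last zs"
    moreover have "distinct (map c (butlast zs))"
      using assms(2) by (simp add: map_butlast distinct_butlast)
    ultimately show ?thesis unfolding rainbow_path_def using W d ne assms(5)
      by (intro exI[of _ "a # zs"]) (auto simp: is_path_def internal_def)
  next
    assume b: "adj G (last zs) b \<and> b \<notin> set zs"
    have "is_walk G ((a # zs) @ [b])"
      using W b ne assms(6) by (subst is_walk_append) (auto simp: is_walk_single)
    then show ?thesis unfolding rainbow_path_def using b d ne assms
      by (intro exI[of _ "a # zs @ [b]"]) (auto simp: is_path_def internal_def butlast_append)
  qed
qed

lemma mod_eq_imp_add:
  fixes x y k :: nat
  assumes "x mod k = y mod k" "x < y" "y < 2 * k"
  shows "y = x + k"
proof -
  have "k dvd y - x" using assms mod_eq_dvd_iff_nat[of x y k] by (metis less_imp_le)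
  then obtain d where d: "y - x = k * d" by blast
  have "d \<noteq> 0" using d assms(2) by (cases "d = 0") auto
  moreover have "d < 2"
  proof (rule ccontr)
    assume "\<not> d < 2"
    then have "k * 2 \<le> k * d" by (intro mult_le_mono2) simp
    then show False using d assms by linarith
  qed
  ultimately have "d = 1" by simp
  then show ?thesis using d assms by simp
qed

context cycle_corona
begin

text \<open>A cycle vertex and the copy on the edge leaving it share a position, because the same
  arcs serve both.\<close>

definition located_at :: "nat + nat set \<times> nat \<Rightarrow> nat \<Rightarrow> bool" where
  "located_at v i \<longleftrightarrow> v = Inl i \<or> (\<exists>w<n. v = X i w)"

lemma walk_Inl:
  assumes "i < j" "j \<le> m"
  shows "is_walk G (map Inl [i..<j])"
  using assms
proof (induction j)
  case (Suc j)
  show ?case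
  proof (cases "i = j")
    case False
    then have "last [i..<j] = j - 1" "i < j" using Suc by auto
    then show ?thesis using Suc
      by (auto simp: is_walk_append is_walk_single last_map adj_G nxt_def)
  qed (use Suc in \<open>auto simp: is_walk_single\<close>)
qed simp

text \<open>As \<open>m <= 2 * k\<close>, cycle vertices of the same colour differ by exactly
  \<open>k\<close>. If \<open>j - i <= k\<close>, the arc \<open>{i<..j}\<close> is rainbow;
  otherwise no two vertices outside it differ by \<open>k\<close>.\<close>

lemma rainbow_path_cyclic_coloring:
  assumes c: "\<And>x. x < m \<Longrightarrow> c (Inl x) = Suc (x mod k)" and k: "m \<le> 2 * k"
    and u: "located_at u i" and v: "located_at v j" and ij: "i < j" "j < m"
  shows "rainbow_path G c u v"
proof -
  have im: "i < m" using ij by simp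
  have V: "u \<in> verts G" "v \<in> verts G" "u \<noteq> v"
    using u v ij by (auto simp: located_at_def X_verts)
  have start: "adj G a (Inl (nxt l))" if "located_at a l" "l < m" for a l
    using that by (auto simp: located_at_def adj_G)
  have stop: "a = Inl l \<or> adj G (Inl l) a \<and> a \<notin> Inl ` A" if "located_at a l" "l < m" for a l A
    using that by (auto simp: located_at_def adj_G)
  have inj: "distinct (map c (map Inl xs))"
    if "distinct xs" "set xs \<subseteq> {..<m}" "\<And>x. x \<in> set xs \<Longrightarrow> x + k \<in> set xs \<Longrightarrow> False" for xs
  proof -
    have "inj_on (\<lambda>x. x mod k) (set xs)"
    proof (rule linorder_inj_onI')
      fix x y assume xy: "x \<in> set xs" "y \<in> set xs" "x < y"
      show "x mod k \<noteq> y mod k"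
      proof
        assume "x mod k = y mod k"
        then have "y = x + k" using mod_eq_imp_add[of x k y] xy that(2) k by auto
        then show False using that(3) xy by blast
      qed
    qed
    then have "inj_on (\<lambda>x. c (Inl x)) (set xs)"
      using that(2) c by (auto simp: inj_on_def subset_iff)
    then show ?thesis using that(1) by (simp add: distinct_map o_def)
  qed
  show ?thesis
  proof (cases "j - i \<le> k")
    case True
    let ?zs = "map Inl [Suc i..<Suc j] :: (nat + nat set \<times> nat) list"
    show ?thesis
    proof (rule rainbow_path_through)
      show "is_walk G ?zs" using ij by (intro walk_Inl) auto
      show "distinct (map c ?zs)" using True ij by (intro inj) auto
      have "hd ?zs = Inl (nxt i)" using ij by (simp add: hd_map nxt_def del: upt_Suc)
      then show "adj G u (hd ?zs)" using start[OF u im] by simp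
      show "u \<notin> set ?zs" using u by (auto simp: located_at_def)
      have "last ?zs = Inl j" using ij by (simp add: last_map)
      then show "v = last ?zs \<or> adj G (last ?zs) v \<and> v \<notin> set ?zs"
        using stop[OF v ij(2), of "set [Suc i..<Suc j]"] by (simp only: set_map)
    qed (use V in auto)
  next
    case False
    \<comment> \<open>The complementary arc runs from \<open>Suc j\<close> through 0 to
      \<open>i\<close>, so the path starts at \<open>v\<close>; the first part is empty if
      \<open>Suc j = m\<close>.\<close>
    let ?xs = "[Suc j..<m] @ [0..<Suc i]"
    let ?zs = "map Inl ?xs :: (nat + nat set \<times> nat) list"
    have "rainbow_path G c v u"
    proof (rule rainbow_path_through)
      have 0: "is_walk G (map Inl [0..<Suc i])" using ij by (intro walk_Inl) auto
      show "is_walk G ?zs"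
      proof (cases "Suc j = m")
        case False
        then have "is_walk G (map Inl [Suc j..<m])" using ij by (intro walk_Inl) auto
        moreover have "last [Suc j..<m] = m - 1" using False ij by auto
        ultimately show ?thesis unfolding map_append using 0 False ij
          by (subst is_walk_append) (auto simp: last_map hd_map adj_G nxt_def simp del: upt_Suc)
      qed (use 0 in simp)
      show "distinct (map c ?zs)"
      proof (rule inj)
        fix x assume x: "x \<in> set ?xs" "x + k \<in> set ?xs"
        have "i + k < j" using False by simp
        then show False using x ij k by auto
      qed (use ij in auto)
      have "hd ?zs = Inl (nxt j)"
        using ij by (cases "Suc j = m") (auto simp: hd_append hd_map nxt_def simp del: upt_Suc)
      then show "adj G v (hd ?zs)" using start[OF v ij(2)] by simp
      show "v \<notin> set ?zs" using v ij by (auto simp: located_at_def)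
      have "last ?zs = Inl i" by (simp add: last_map)
      then show "u = last ?zs \<or> adj G (last ?zs) u \<and> u \<notin> set ?zs"
        using stop[OF u im, of "set ?xs"] by (simp only: set_map)
    qed (use V in auto)
    then show ?thesis by (rule rainbow_path_sym)
  qed
qed

lemma rainbow_cyclic_coloring:
  assumes c: "\<And>x. x < m \<Longrightarrow> c (Inl x) = Suc (x mod k)" and k: "m \<le> 2 * k"
    and R: "\<And>v. v \<in> verts G \<Longrightarrow> c v \<in> {1..k}"
  shows "rainbow_vertex_coloring G k c"
proof -
  have "rainbow_path G c u v" if uv: "u \<in> verts G" "v \<in> verts G" "u \<noteq> v" for u v
  proof -
    have L: "\<exists>i<m. located_at a i" if "a \<in> verts G" for a
      using that by (cases rule: verts_cases) (auto simp: located_at_def)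
    obtain i j where ij: "i < m" "located_at u i" "j < m" "located_at v j"
      using L uv by blast
    consider "i < j" | "j < i" | "i = j" by linarith
    then show ?thesis
    proof cases
      case 1
      then show ?thesis using rainbow_path_cyclic_coloring[OF c k] ij by blast
    next
      case 2
      show ?thesis
        by (rule rainbow_path_sym, rule rainbow_path_cyclic_coloring[OF c k]) (use 2 ij in auto)
    next
      case 3
      then have "adj G u v" using ij uv by (auto simp: located_at_def adj_G)
      then show ?thesis using uv by (intro rainbow_path_adj)
    qed
  qed
  then show ?thesis using R unfolding rainbow_vertex_coloring_def rainbow_path_def by blast
qed

end

section \<open>Colourings with prescribed missing colours\<close>

context cycle_corona
begin

text \<open>\<open>M i\<close> is the set of colours missing in copy \<open>i\<close>. Then \<open>N i\<close> and \<open>P x\<close> are the colours at distance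
  at least 2 from the vertices of copy \<open>i\<close> and from the cycle vertex \<open>x\<close>, respectively.\<close>

lemma locating_coloring_exists:
  fixes k :: nat and M N P :: "nat \<Rightarrow> nat set"
  assumes k: "m \<le> 2 * k" "n \<le> k"
    and M: "\<And>i. i < m \<Longrightarrow> M i \<subseteq> {..<k}" "\<And>i. i < m \<Longrightarrow> card (M i) = k - n"
    and N: "\<And>i. i < m \<Longrightarrow> N i = M i - {i mod k, nxt i mod k}"
    and P: "\<And>x. x < m \<Longrightarrow> P x = M x \<inter> M (prv x) - {prv x mod k, x mod k, nxt x mod k}"
    and NN: "\<And>i j. i < m \<Longrightarrow> j < m \<Longrightarrow> N i = N j \<Longrightarrow> i = j"
    and PP: "\<And>x y. x < m \<Longrightarrow> y < m \<Longrightarrow> x mod k = y mod k \<Longrightarrow> P x = P y \<Longrightarrow> x = y"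
    and PN: "\<And>x j. x < m \<Longrightarrow> j < m \<Longrightarrow> x mod k \<notin> M j \<Longrightarrow> P x \<noteq> N j"
  shows "\<exists>c. locating_rainbow_coloring G k c"
proof -
  have k0: "0 < k" using k m3 by linarith
  have "\<exists>h. bij_betw h {..<n} ({..<k} - M i)" if "i < m" for i
  proof -
    have "card ({..<k} - M i) = card {..<n}"
      using M[OF that] k by (simp add: card_Diff_subset finite_subset)
    then show ?thesis by (intro finite_same_card_bij) auto
  qed
  then obtain g where g: "\<And>i. i < m \<Longrightarrow> bij_betw (g i) {..<n} ({..<k} - M i)" by metis
  \<comment> \<open>\<open>ix\<close> recovers the index of a copy from the edge stored in its
    vertices.\<close>
  define ix where "ix = the_inv_into {..<m} (\<lambda>i. {i, nxt i})"
  have ix: "ix {i, nxt i} = i" if "i < m" for i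
    unfolding ix_def using that by (intro the_inv_into_f_f) (auto simp: inj_on_def)
  define c :: "nat + nat set \<times> nat \<Rightarrow> nat" where
    "c = case_sum (\<lambda>x. Suc (x mod k)) (\<lambda>(e, w). Suc (g (ix e) w))"
  have cI: "c (Inl x) = Suc (x mod k)" for x by (simp add: c_def)
  have cX: "c (X i w) = Suc (g i w)" if "i < m" for i w using that by (simp add: c_def X_def ix)
  have gX: "g i w < k" "g i w \<notin> M i" if "i < m" "w < n" for i w
    using g[OF that(1)] that(2) by (auto dest: bij_betwE)
  have CC: "copy_colors c i = Suc ` ({..<k} - M i)" if "i < m" for i
    using bij_betw_imp_surj_on[OF g[OF that]] cX[OF that] by (auto simp: copy_colors_def image_image)
  have C: "c v \<in> {1..k}" if "v \<in> verts G" for v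
    using that by (cases rule: verts_cases) (use k0 gX in \<open>auto simp: cI cX less_eq_Suc_le[symmetric]\<close>)
  have Seq: "{1..k} = Suc ` {..<k}" by (simp add: image_Suc_lessThan)
  have LX: "{1..k} - insert (c (X i w)) (nbr_colors G c (X i w)) = Suc ` N i" if "i < m" "w < n" for i w
    unfolding nbr_colors_copy[OF that] CC[OF that(1)] cI Seq N[OF that(1)]
    using M(1)[OF that(1)] by auto
  have LI: "{1..k} - insert (c (Inl x)) (nbr_colors G c (Inl x)) = Suc ` P x" if "x < m" for x
    using M(1)[OF that] that unfolding nbr_colors_cycle[OF that] cI Seq P[OF that] by (auto simp: CC)
  have "rainbow_vertex_coloring G k c" using cI k(1) C by (rule rainbow_cyclic_coloring)
  moreover have "inj_on (rainbow_code G k c) (verts G)"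
  proof (rule inj_onI)
    fix u v assume uv: "u \<in> verts G" "v \<in> verts G" "rainbow_code G k c u = rainbow_code G k c v"
    have E: "c u = c v" "{1..k} - insert (c u) (nbr_colors G c u) = {1..k} - insert (c v) (nbr_colors G c v)"
      using rainbow_code_eqD[OF uv(3,1,2) C] by simp_all
    \<comment> \<open>A colour used in copy \<open>j\<close> is not in \<open>M j\<close>, which is
      the condition of \<open>PN\<close>.\<close>
    have mixed: False if "c (Inl x) = c (X j w)" "P x = N j" "x < m" "j < m" "w < n" for x j w
      using that PN[of x j] gX[of j w] by (simp add: cI cX)
    have inj_Suc: "A = B" if "Suc ` A = Suc ` B" for A B using that by (simp add: inj_image_eq_iff)
    from uv(1) show "u = v"
    proof (cases rule: verts_cases)
      case u: (cycle x)
      from uv(2) show ?thesis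
      proof (cases rule: verts_cases)
        case v: (cycle y)
        have "P x = P y" by (rule inj_Suc, fold LI[OF u(1)] LI[OF v(1)]) (use E(2) u v in simp)
        moreover have "x mod k = y mod k" using E(1) u v by (simp add: cI)
        ultimately show ?thesis using PP u v by blast
      next
        case v: (copy j w)
        have "P x = N j" by (rule inj_Suc, fold LI[OF u(1)] LX[OF v(1,2)]) (use E(2) u v in simp)
        then show ?thesis using mixed[of x j w] E(1) u v by simp
      qed
    next
      case u: (copy i w)
      from uv(2) show ?thesis
      proof (cases rule: verts_cases)
        case v: (cycle y)
        have "P y = N i" by (rule inj_Suc, fold LI[OF v(1)] LX[OF u(1,2)]) (use E(2) u v in simp)
        then show ?thesis using mixed[of y i w] E(1) u v by simp
      next
        case v: (copy j w')
        have "N i = N j" by (rule inj_Suc, fold LX[OF u(1,2)] LX[OF v(1,2)]) (use E(2) u v in simp)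
        then have ij: "i = j" using NN u v by blast
        moreover have "g i w = g i w'" using E(1) u v ij by (simp add: cX)
        then have "w = w'" using g[OF u(1)] u v by (auto simp: bij_betw_def inj_on_def)
        ultimately show ?thesis using u v by simp
      qed
    qed
  qed
  ultimately show ?thesis unfolding locating_rainbow_coloring_def by blast
qed

text \<open>The cycle vertices have distinct colours. Copy \<open>i\<close> misses only
  \<open>nxt (nxt i)\<close>, which differs from its end colours and from copy to copy, so every
  cycle vertex is full.\<close>

lemma locating_coloring_few_edges:
  assumes "m \<le> n + 1"
  shows "\<exists>c. locating_rainbow_coloring G (n + 1) c"
proof (rule locating_coloring_exists[of "n + 1" "\<lambda>i. {nxt (nxt i)}" "\<lambda>i. {nxt (nxt i)}" "\<lambda>_. {}"])
  have md: "x mod Suc n = x" if "x < m" for x using that assms by simp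
  fix i j assume ij: "i < m" "j < m"
  show "{nxt (nxt i)} \<subseteq> {..<n + 1}" using ij(1) assms by (auto intro: less_le_trans[of _ m])
  show "{nxt (nxt i)} = {nxt (nxt i)} - {i mod (n + 1), nxt i mod (n + 1)}"
    using ij(1) by (auto simp: md)
  show "{} = {nxt (nxt i)} \<inter> {nxt (nxt (prv i))}
      - {prv i mod (n + 1), i mod (n + 1), nxt i mod (n + 1)}"
    using ij(1) by simp
  show "i = j" if "{nxt (nxt i)} = {nxt (nxt j)}"
  proof -
    have "prv (prv (nxt (nxt i))) = prv (prv (nxt (nxt j)))" using that by simp
    then show ?thesis using ij by simp
  qed
  show "i = j" if "i mod (n + 1) = j mod (n + 1)" using ij that by (simp add: md)
qed (use assms n1 in auto)

end

section \<open>Cyclic windows of missing colours\<close>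

definition cyc_suc :: "nat \<Rightarrow> nat \<Rightarrow> nat" where
  "cyc_suc k a = (if Suc a = k then 0 else Suc a)"

text \<open>\<open>window k a s\<close> consists of the \<open>s\<close> cyclically consecutive colours starting at \<open>a + 2\<close>, the first
  colour that a copy with ends coloured \<open>a\<close> and \<open>a + 1\<close> does not see on the cycle.\<close>

definition offset :: "nat \<Rightarrow> nat \<Rightarrow> nat \<Rightarrow> nat" where
  "offset k a c = (if a + 2 \<le> c then c - (a + 2) else if a + 2 \<le> c + k then c + k - (a + 2) else k - 1)"

definition window :: "nat \<Rightarrow> nat \<Rightarrow> nat \<Rightarrow> nat set" where
  "window k a s = {c. c < k \<and> offset k a c < s}"

lemma mem_window: "c \<in> window k a s \<longleftrightarrow> c < k \<and> offset k a c < s"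
  by (simp add: window_def)

lemma window_subset: "window k a s \<subseteq> {..<k}"
  by (auto simp: window_def)

lemma finite_window [simp]: "finite (window k a s)"
  by (rule finite_subset[OF window_subset]) simp

text \<open>For \<open>a < k\<close>, \<open>offset k a\<close> is the position in the cyclic order
  from \<open>a + 2\<close>; on colours below \<open>k\<close> its last branch is just
  \<open>a = k - 1\<close>, \<open>c = 0\<close>. In the inverse, \<open>s < k\<close> keeps
  \<open>a + 2 + t\<close> below \<open>2 * k\<close>, so one subtraction suffices.\<close>

lemma card_window:
  assumes "a < k" "s < k"
  shows "card (window k a s) = s"
proof -
  have "bij_betw (offset k a) (window k a s) {..<s}"
  proof (rule bij_betw_byWitness[where f' = "\<lambda>t. if a + 2 + t < k then a + 2 + t else a + 2 + t - k"])
    show "offset k a ` window k a s \<subseteq> {..<s}" by (auto simp: window_def)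
    show "(\<lambda>t. if a + 2 + t < k then a + 2 + t else a + 2 + t - k) ` {..<s} \<subseteq> window k a s"
      using assms by (auto simp: window_def offset_def)
  qed (use assms in \<open>auto simp: window_def offset_def\<close>)
  then show ?thesis by (simp add: bij_betw_same_card)
qed

lemma window_inject:
  assumes "a < k" "b < k" "0 < s" "s < k" "0 < t" "t < k" "window k a s = window k b t"
  shows "a = b" "s = t"
proof -
  show st: "s = t" using card_window[of a k s] card_window[of b k t] assms by simp
  have E: "c \<in> window k a s \<longleftrightarrow> c \<in> window k b t" for c using assms by simp
  \<comment> \<open>\<open>e\<close> starts the window at \<open>a\<close>, and \<open>d\<close>
    precedes it. A nonempty proper cyclic interval has only one member whose predecessor lies
    outside.\<close>
  define e where "e = (if a + 2 < k then a + 2 else a + 2 - k)"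
  define d where "d = (if a + 1 < k then a + 1 else 0)"
  have "offset k a e = 0" "offset k a d = k - 1" "e < k" "d < k"
    using assms(1,3,4) by (auto simp: offset_def e_def d_def)
  then have "offset k b e < s" "\<not> offset k b d < s"
    using E[of e] E[of d] st assms by (auto simp: mem_window)
  then show "a = b"
    using assms(1-4) by (auto simp: offset_def e_def d_def split: if_splits)
qed

text \<open>In the cyclic order from \<open>a + 2\<close> the colours \<open>a\<close> and
  \<open>a + 1\<close> come last, so windows of width at most \<open>k - 2\<close> avoid
  them.\<close>

lemma offset_simps:
  assumes "a < k" "3 \<le> k"
  shows "offset k a a = k - 2" "offset k a (cyc_suc k a) = k - 1" "offset k (cyc_suc k a) a = k - 3"
  using assms by (auto simp: offset_def cyc_suc_def)

lemma offset_cyc_suc: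
  assumes "a < k" "c < k" "3 \<le> k" "c \<noteq> cyc_suc k (cyc_suc k a)"
  shows "offset k a c = Suc (offset k (cyc_suc k a) c)"
proof (cases "Suc a = k")
  case True
  then show ?thesis using assms by (auto simp: offset_def cyc_suc_def)
next
  case False
  then show ?thesis using assms by (auto simp: offset_def cyc_suc_def split: if_splits)
qed

lemma cyc_suc_less: "a < k \<Longrightarrow> cyc_suc k a < k"
  by (auto simp: cyc_suc_def)

lemma window_diff_ends:
  assumes "a < k" "s + 2 \<le> k" "3 \<le> k"
  shows "window k a s \<union> (if t then {a} else {}) - {a, cyc_suc k a} = window k a s"
  using assms offset_simps[OF assms(1,3)] by (auto simp: mem_window)

text \<open>Moving the start from \<open>a\<close> to \<open>b\<close> drops the first colour of the
  window, \<open>cyc_suc k b\<close>, which is subtracted anyway; \<open>s' <= Suc s\<close> makes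
  the rest of the window at \<open>a\<close> the smaller one.\<close>

lemma window_inter:
  assumes "a < k" "s + 2 \<le> k" "s' + 2 \<le> k" "s' \<le> Suc s" "0 < s'" and b: "b = cyc_suc k a"
  shows "(window k b s \<union> (if t then {b} else {})) \<inter> (window k a s' \<union> (if t' then {a} else {}))
    - {a, b, cyc_suc k b} = window k b (s' - 1)"
proof -
  have k3: "3 \<le> k" using assms by simp
  have bk: "b < k" using cyc_suc_less assms by simp
  have "x \<in> window k a s' \<longleftrightarrow> Suc (offset k b x) < s'" if "x < k" "x \<noteq> cyc_suc k b" for x
    using offset_cyc_suc[OF assms(1) that(1) k3] that b by (simp add: mem_window)
  then have eq: "x \<in> window k b s \<and> x \<in> window k a s' \<longleftrightarrow> x \<in> window k b (s' - 1)"
    if "x < k" "x \<noteq> cyc_suc k b" for x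
    using that assms(4,5) by (auto simp: mem_window)
  have notin: "a \<notin> window k b (s' - 1)" "b \<notin> window k b (s' - 1)" "cyc_suc k b \<notin> window k b (s' - 1)"
    using offset_simps[OF assms(1) k3] offset_simps[OF bk k3] assms by (auto simp: mem_window)
  show ?thesis
  proof (rule set_eqI)
    fix x
    show "x \<in> (window k b s \<union> (if t then {b} else {})) \<inter> (window k a s' \<union> (if t' then {a} else {}))
      - {a, b, cyc_suc k b} \<longleftrightarrow> x \<in> window k b (s' - 1)"
    proof (cases "x \<in> {a, b, cyc_suc k b}")
      case True
      then show ?thesis using notin by auto
    next
      case False
      then have "x \<noteq> a" "x \<noteq> b" "x \<noteq> cyc_suc k b" by auto
      then show ?thesis using eq[of x] by (cases "x < k") (simp_all add: mem_window)
    qed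
  qed
qed

text \<open>Copy \<open>i\<close> misses the window of width \<open>q\<close> at its colour \<open>i mod k\<close>, or, if \<open>T i\<close> holds, the colour
  \<open>i mod k\<close> together with the window of width \<open>q - 1\<close>. A normal cycle vertex \<open>x\<close> then misses the window
  that is one narrower than that of the preceding copy, so letting \<open>T\<close> separate the first \<open>k\<close> copies from
  the others distinguishes the two vertices of a colour. Unless \<open>k\<close> divides \<open>m\<close>, the last copy lies
  between vertices whose colours are not consecutive and gets an individual set \<open>L\<close>.\<close>

locale window_design = cycle_corona +
  fixes k q :: nat and T :: "nat \<Rightarrow> bool" and L :: "nat set"
  assumes q2: "2 \<le> q" and qk: "q + 2 \<le> k" and km: "k \<le> m" "m \<le> 2 * k" and nq: "n + q = k"
    and T_ge: "k \<le> i \<Longrightarrow> T i"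
    and T_lt: "i < k \<Longrightarrow> T i \<Longrightarrow> i + 2 = k \<and> k < m \<and> m < 2 * k"
    and L: "L \<subseteq> {..<k}" "card L = q"
begin

definition special :: "nat \<Rightarrow> bool" where
  "special i \<longleftrightarrow> k < m \<and> m < 2 * k \<and> Suc i = m"

definition width :: "nat \<Rightarrow> nat" where
  "width i = (if T i then q - 1 else q)"

definition M :: "nat \<Rightarrow> nat set" where
  "M i = (if special i then L else window k (i mod k) (width i) \<union> (if T i then {i mod k} else {}))"

definition N :: "nat \<Rightarrow> nat set" where
  "N i = M i - {i mod k, nxt i mod k}"

definition P :: "nat \<Rightarrow> nat set" where
  "P x = M x \<inter> M (prv x) - {prv x mod k, x mod k, nxt x mod k}"

lemma k_pos [simp]: "0 < k" using qk by simp

lemma width_bounds: "0 < width i" "width i + 2 \<le> k" "width i \<le> q" "q \<le> Suc (width i)"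
  using q2 qk by (auto simp: width_def)

lemma M_subset: "M i \<subseteq> {..<k}"
  using L(1) window_subset[of k "i mod k" "width i"] by (auto simp: M_def)

lemma card_M: "card (M i) = q"
proof (cases "special i")
  case False
  have c: "card (window k (i mod k) (width i)) = width i"
    using width_bounds[of i] by (intro card_window) auto
  moreover have "i mod k \<notin> window k (i mod k) (width i)"
    using offset_simps(1)[of "i mod k" k] width_bounds[of i] by (simp add: mem_window)
  ultimately show ?thesis using False q2 by (auto simp: M_def width_def)
qed (simp add: M_def L)

lemma nxt_mod_k:
  assumes "i < m" "\<not> special i"
  shows "nxt i mod k = cyc_suc k (i mod k)"
proof (cases "Suc i = m")
  case True
  then have "m = k \<or> m = 2 * k" using assms(2) km by (auto simp: special_def)
  then have "Suc i mod k = 0" using True by auto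
  then have "Suc (i mod k) = k" using mod_Suc[of i k] by (metis nat.distinct(1))
  then show ?thesis using True by (simp add: nxt_def cyc_suc_def)
qed (auto simp: nxt_def cyc_suc_def mod_Suc)

lemma N_normal:
  assumes "i < m" "\<not> special i"
  shows "N i = window k (i mod k) (width i)"
  using assms width_bounds[of i] window_diff_ends[of "i mod k" k "width i" "T i"]
  by (simp add: N_def M_def nxt_mod_k)

lemma P_normal:
  assumes "x < m" "\<not> special x" "\<not> special (prv x)"
  shows "P x = window k (x mod k) (width (prv x) - 1)"
proof -
  have "x mod k = cyc_suc k (prv x mod k)"
    using nxt_mod_k[of "prv x"] assms by simp
  moreover have "width (prv x) \<le> Suc (width x)" using width_bounds(3,4) order_trans by blast
  ultimately show ?thesis
    using window_inter[of "prv x mod k" k "width x" "width (prv x)" "x mod k" "T x" "T (prv x)"]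
      width_bounds assms by (simp add: P_def M_def nxt_mod_k)
qed

lemma card_N_normal: "i < m \<Longrightarrow> \<not> special i \<Longrightarrow> card (N i) = width i"
  using width_bounds[of i] by (simp add: N_normal card_window)

lemma card_P_normal:
  "x < m \<Longrightarrow> \<not> special x \<Longrightarrow> \<not> special (prv x) \<Longrightarrow> card (P x) = width (prv x) - 1"
  using width_bounds[of "prv x"] by (simp add: P_normal card_window)

lemma special_prv: "x < m \<Longrightarrow> special (prv x) \<longleftrightarrow> k < m \<and> m < 2 * k \<and> x = 0"
  using m3 by (auto simp: special_def prv_def)

text \<open>Normal vertices are separated here, since windows of different start or width differ.
  The assumptions are the comparisons involving the last copy or its ends \<open>0\<close> and
  \<open>m - 1\<close>.\<close>

lemma locating_coloring:
  assumes NN: "\<And>i. k < m \<Longrightarrow> m < 2 * k \<Longrightarrow> i < m - 1 \<Longrightarrow> N i \<noteq> N (m - 1)"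
    and PP: "k < m \<Longrightarrow> m < 2 * k \<Longrightarrow> P 0 \<noteq> P k" "k < m \<Longrightarrow> m < 2 * k \<Longrightarrow> P (m - 1 - k) \<noteq> P (m - 1)"
    and PN: "\<And>x. k < m \<Longrightarrow> m < 2 * k \<Longrightarrow> x < m \<Longrightarrow> x mod k \<notin> L \<Longrightarrow> P x \<noteq> N (m - 1)"
    and PN0: "\<And>j. k < m \<Longrightarrow> m < 2 * k \<Longrightarrow> j < m - 1 \<Longrightarrow> P 0 \<noteq> N j"
    and PNe: "\<And>j. k < m \<Longrightarrow> m < 2 * k \<Longrightarrow> j < m - 1 \<Longrightarrow> P (m - 1) \<noteq> N j"
  shows "\<exists>c. locating_rainbow_coloring G k c"
proof (rule locating_coloring_exists[of k M N P])
  have same: "j = i + k" if "i mod k = j mod k" "i < j" "j < m" for i j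
    using that km by (intro mod_eq_imp_add) auto
  have N_less: "N i \<noteq> N j" if "i < j" "j < m" for i j
  proof (cases "special j")
    case True
    then show ?thesis using NN that by (auto simp: special_def)
  next
    case False
    have i: "i < m" "\<not> special i" using that by (auto simp: special_def)
    show ?thesis
    proof
      assume "N i = N j"
      then have E: "i mod k = j mod k" "width i = width j"
        using window_inject[of "i mod k" k "j mod k" "width i" "width j"]
          width_bounds[of i] width_bounds[of j] i False that by (simp_all add: N_normal)
      then have j: "j = i + k" using same that by blast
      \<comment> \<open>\<open>T\<close> holds at \<open>j\<close>, hence at \<open>i\<close>. Then
        \<open>T_lt\<close> gives \<open>i = k - 2\<close> and \<open>m < 2 * k\<close>, so
        \<open>j = 2 * k - 2\<close> would be the special copy.\<close>
      then have "T i" using E(2) T_ge[of j] q2 by (auto simp: width_def split: if_splits)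
      then show False using T_lt[of i] j that False km by (auto simp: special_def)
    qed
  qed
  have P_less: "P x \<noteq> P y" if "x < y" "y < m" "x mod k = y mod k" for x y
  proof -
    have y: "y = x + k" using same that by blast
    consider "special y" | "special (prv x)" | "\<not> special y" "\<not> special (prv x)" by blast
    then show ?thesis
    proof cases
      case 1
      then show ?thesis using PP(2) y by (auto simp: special_def)
    next
      case 2
      then show ?thesis using PP(1) y that by (simp add: special_prv)
    next
      case 3
      have n: "x < m" "\<not> special x" "\<not> special (prv y)"
        using that y special_prv[OF that(2)] by (auto simp: special_def[of x])
      show ?thesis
      proof
        assume "P x = P y"
        then have "width (prv x) - 1 = width (prv y) - 1"
          using card_P_normal n 3 that by metis
        then have W: "T (prv x) = T (prv y)"
          using q2 by (auto simp: width_def split: if_splits)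
        show False
        proof (cases "x = 0")
          case True
          \<comment> \<open>The predecessors are \<open>m - 1\<close> and \<open>k - 1\<close>, and
            here \<open>m = 2 * k\<close>, so \<open>T\<close> holds only at the first.\<close>
          then have "\<not> T (prv y)" using y qk T_lt[of "k - 1"] by (auto simp: prv_def)
          then show False using W True 3 y km that T_ge[of "m - 1"] qk by (auto simp: prv_def special_def)
        next
          case False
          then have "T (prv x)" using W y T_ge by (auto simp: prv_def)
          moreover have "x - 1 < k" using y that km by linarith
          ultimately have "x + 1 = k \<and> m < 2 * k" using T_lt[of "x - 1"] False by (simp add: prv_def)
          then show False using y that by linarith
        qed
      qed
    qed
  qed
  fix i j assume ij: "i < m" "j < m"
  show "M i \<subseteq> {..<k}" by (rule M_subset)
  show "card (M i) = k - n" using nq by (simp add: card_M)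
  show "i = j" if "N i = N j"
    using N_less that ij by (metis linorder_less_linear)
  show "i = j" if "i mod k = j mod k" "P i = P j"
    using P_less that ij by (metis linorder_less_linear)
  show "P i \<noteq> N j" if "i mod k \<notin> M j"
  proof -
    consider "special j" | "\<not> special j" "special i" | "\<not> special j" "special (prv i)"
      | "\<not> special j" "\<not> special i" "\<not> special (prv i)" by blast
    then show ?thesis
    proof cases
      case 1
      then have "M j = L" by (simp add: M_def)
      then show ?thesis using PN[of i] that ij 1 by (auto simp: special_def)
    next
      case 2
      then show ?thesis using PNe[of j] ij by (auto simp: special_def)
    next
      case 3
      then show ?thesis using PN0[of j] ij special_prv[of i] by (auto simp: special_def)
    next
      case 4
      show ?thesis
      proof
        assume E: "P i = N j"
        then have W: "width (prv i) - 1 = width j"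
          using card_P_normal card_N_normal 4 ij by metis
        \<comment> \<open>Equal widths force \<open>width j = q - 1\<close>. This is why
          \<open>M j\<close> then includes \<open>j mod k\<close>: no vertex of copy
          \<open>j\<close> has the colour of \<open>i\<close>.\<close>
        then have "T j" using q2 by (auto simp: width_def split: if_splits)
        moreover have "i mod k = j mod k"
          using E W window_inject[of "i mod k" k "j mod k" "width j" "width j"] width_bounds[of j] 4 ij
          by (simp add: P_normal N_normal)
        ultimately show False using that 4 by (simp add: M_def)
      qed
    qed
  qed
qed (use km nq in \<open>auto simp: N_def P_def\<close>)

text \<open>In the next three lemmas \<open>m\<close> is fixed by two inequalities: an equation would be used to
  substitute \<open>m\<close>, which is a hidden parameter of the constants of the locale.\<close>

lemma locating_coloring_one_more:
  assumes m: "m \<le> k + 1" "k + 1 \<le> m"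
    and T: "\<And>i. T i \<longleftrightarrow> k \<le> i" and L_iff: "\<And>x. x \<in> L \<longleftrightarrow> x = q + 1 \<or> 1 \<le> x \<and> x < q"
  shows "\<exists>c. locating_rainbow_coloring G k c"
proof -
  note q = q2 qk
  have sp: "special i \<longleftrightarrow> i = k" for i using m q by (auto simp: special_def)
  have Mk: "M k = L" by (simp add: M_def sp)
  have nk: "nxt k = 0" "prv 0 = k" "prv k = k - 1" "nxt 0 = 1"
    using m q by (auto simp: nxt_def prv_def)
  have Nk: "N k = L" using q by (auto simp: N_def Mk L_iff nk)
  have win: "N i = window k i q" "M i = window k i q" if "i < k" for i
    using that m N_normal[of i] by (auto simp: sp width_def T M_def)
  \<comment> \<open>All \<open>N i\<close> have exactly \<open>q\<close> elements and all
    \<open>P x\<close> fewer, which settles every mixed comparison.\<close>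
  have cN: "card (N i) = q" if "i < m" for i
    using that m win card_window[of i k q] q Nk L(2) by (cases "i = k") auto
  have P0: "P 0 = window k 0 q \<inter> L - {0, 1}"
    using q m by (simp add: P_def win Mk insert_commute nk)
  have Pk: "P k = window k (k - 1) q \<inter> L - {0, k - 1}"
    using q m by (simp add: P_def win Mk insert_commute Int_commute nk)
  \<comment> \<open>The gap \<open>q\<close> of \<open>L\<close> lies in both windows,
    \<open>{2..q + 1}\<close> at 0 and \<open>{1..q}\<close> at \<open>k - 1\<close>, so
    \<open>P 0\<close> and \<open>P k\<close> are proper subsets.\<close>
  have card_less: "card A < q" if "A \<subseteq> window k a q" "q \<in> window k a q" "q \<notin> A" "a < k" for A a
    using that card_window[of a k q] q psubset_card_mono[of "window k a q" A] by auto
  have cP: "card (P x) < q" if "x < m" for x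
  proof -
    have "x = 0 \<or> x = k \<or> 0 < x \<and> x < k" using that m by linarith
    then consider "x = 0" | "x = k" | "0 < x" "x < k" by blast
    then show ?thesis
    proof cases
      case 1
      then show ?thesis unfolding 1 P0 using q
        by (intro card_less[of _ 0]) (auto simp: mem_window offset_def L_iff)
    next
      case 2
      then show ?thesis unfolding 2 Pk using q
        by (intro card_less[of _ "k - 1"]) (auto simp: mem_window offset_def L_iff)
    next
      case 3
      then show ?thesis using card_P_normal[of x] that q m by (simp add: sp prv_def width_def T)
    qed
  qed
  show ?thesis
  proof (rule locating_coloring)
    fix i assume "i < m - 1"
    then have i: "i < k" using m by simp
    show "N i \<noteq> N (m - 1)"
    proof
      assume "N i = N (m - 1)"
      moreover have "m - 1 = k" using m by simp
      ultimately have "window k i q = L" using Nk win[OF i] by simp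
      then have *: "c \<in> window k i q \<longleftrightarrow> c \<in> L" for c by simp
      \<comment> \<open>\<open>L\<close> contains 1 but neither 0 nor \<open>q\<close>, while a
        window of width \<open>q\<close> that starts at 1 contains \<open>q\<close>.\<close>
      show False using *[of 0] *[of 1] *[of q] i q
        by (auto simp: mem_window offset_def L_iff split: if_splits)
    qed
    show "P 0 \<noteq> N i" using cP[of 0] cN[of i] i m by auto
    show "P (m - 1) \<noteq> N i" using cP[of "m - 1"] cN[of i] i m by auto
  next
    have "q + 1 \<in> P 0" "q + 1 \<notin> P k"
      unfolding P0 Pk using q by (auto simp: mem_window offset_def L_iff)
    then show "P 0 \<noteq> P k" "P (m - 1 - k) \<noteq> P (m - 1)" using m by auto
  next
    fix x assume "x < m"
    then show "P x \<noteq> N (m - 1)" using cP[of x] cN[of "m - 1"] m by auto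
  qed
qed

text \<open>\<open>L\<close> contains the residues \<open>r\<close> and 0 of the ends of the last
  copy, so \<open>N (m - 1)\<close> has \<open>q - 2\<close> elements, fewer than any other
  \<open>N i\<close>, and it contains \<open>P 0\<close> and \<open>P (m - 1)\<close>. Colour 1
  keeps it apart from the \<open>P x\<close> with \<open>q - 2\<close> elements.\<close>

lemma locating_coloring_long_wide:
  assumes r: "m \<le> k + 1 + r" "k + 1 + r \<le> m" "1 \<le> r" "r + 2 \<le> k"
    and or: "3 \<le> q \<or> r = 1"
    and T: "\<And>i. T i \<longleftrightarrow> k \<le> i" and L_mem: "0 \<in> L" "r \<in> L" "r \<ge> 2 \<Longrightarrow> 1 \<in> L"
  shows "\<exists>c. locating_rainbow_coloring G k c"
proof -
  note q = q2 qk
  have sp: "special i \<longleftrightarrow> i = m - 1" for i using r q by (auto simp: special_def)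
  have e: "nxt (m - 1) = 0" "(m - 1) mod k = r" "prv 0 = m - 1" "m - 1 - k = r"
    using r by (auto simp: nxt_def prv_def)
  have Me: "M (m - 1) = L" by (simp add: M_def sp)
  then have Ne: "N (m - 1) = L - {r, 0}" using e by (simp add: N_def)
  have cNe: "card (N (m - 1)) = q - 2"
    unfolding Ne using L L_mem r finite_subset[OF L(1)] by (subst card_Diff_subset) auto
  have cN: "q - 1 \<le> card (N i)" if "i < m - 1" for i
    using that card_N_normal[of i] width_bounds[of i] by (simp add: sp)
  have "P 0 \<subseteq> N (m - 1)" "P (m - 1) \<subseteq> N (m - 1)"
    using e by (auto simp: P_def N_def)
  then have cP: "card (P 0) \<le> q - 2" "card (P (m - 1)) \<le> q - 2"
    using cNe card_mono[of "N (m - 1)"] finite_subset[OF M_subset[of "m - 1"]] by (auto simp: N_def)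
  have Pn: "P x = window k (x mod k) (width (prv x) - 1)" "card (P x) = width (prv x) - 1"
    if "0 < x" "x < m - 1" for x
    using that P_normal[of x] card_P_normal[of x] special_prv[of x] sp[of x] by auto
  show ?thesis
  proof (rule locating_coloring)
    fix i assume i: "i < m - 1"
    show "N i \<noteq> N (m - 1)" using cNe cN[OF i] q by auto
    show "P 0 \<noteq> N i" using cP cN[OF i] q by auto
    show "P (m - 1) \<noteq> N i" using cP cN[OF i] q by auto
  next
    have "card (P k) = q - 1" using Pn(2)[of k] r q by (simp add: prv_def width_def T)
    then show "P 0 \<noteq> P k" using cP q by auto
    have "card (P r) = q - 1" using Pn(2)[of r] r q by (simp add: prv_def width_def T)
    then show "P (m - 1 - k) \<noteq> P (m - 1)" using cP q e by auto
  next
    fix x assume x: "x < m" "x mod k \<notin> L"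
    have x0: "0 < x" using x L_mem(1) by (cases "x = 0") auto
    have xe: "x < m - 1" using x L_mem(2) e(2) by (cases "x = m - 1") auto
    show "P x \<noteq> N (m - 1)"
    proof
      assume E: "P x = N (m - 1)"
      then have "width (prv x) - 1 = q - 2" using Pn(2)[OF x0 xe] cNe by simp
      then have "width (prv x) = q - 1" using width_bounds[of "prv x"] q by linarith
      then have "k \<le> prv x" using q by (auto simp: width_def T split: if_splits)
      then have xk: "k < x" using x0 by (simp add: prv_def)
      then have xm: "x mod k = x - k" "x - k < r" using xe r by (auto simp: mod_if)
      then have r2: "r \<ge> 2" "q \<ge> 3" using or xk by auto
      have W: "window k (x - k) (q - 2) = L - {r, 0}"
        using E Pn(1)[OF x0 xe] \<open>width (prv x) = q - 1\<close> Ne xm by (simp add: numeral_2_eq_2)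
      \<comment> \<open>The window starts at \<open>x - k + 2 > 2\<close>, so it reaches 1 only
        through 0, which \<open>N (m - 1)\<close> omits.\<close>
      have "1 \<in> window k (x - k) (q - 2)" using W L_mem(3) r2 by auto
      then have "0 \<in> window k (x - k) (q - 2)"
        using xm xk r q by (auto simp: mem_window offset_def split: if_splits)
      then show False using W by auto
    qed
  qed
qed

text \<open>With \<open>q = 2\<close>, \<open>L\<close> has no room for 0, 1 and \<open>r\<close>.
  For \<open>L = {0, 1}\<close> the last copy has \<open>N (m - 1) = {1}\<close>, the window of
  width 1 at \<open>k - 1\<close>. \<open>N (k - 1)\<close> is wider, and \<open>T (k - 2)\<close>
  empties \<open>P (k - 1)\<close>, which would otherwise be equal to it.\<close>

lemma locating_coloring_long_narrow:
  assumes r: "m \<le> k + 1 + r" "k + 1 + r \<le> m" "2 \<le> r" "r + 2 \<le> k" and q: "q \<le> 2"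
    and T: "\<And>i. T i \<longleftrightarrow> k \<le> i \<or> i + 2 = k" and L_iff: "\<And>x. x \<in> L \<longleftrightarrow> x = 0 \<or> x = 1"
  shows "\<exists>c. locating_rainbow_coloring G k c"
proof -
  have k: "4 \<le> k" using q2 qk by simp
  have width: "width i = (if k \<le> i \<or> i + 2 = k then 1 else 2)" for i
    unfolding width_def T using q q2 by auto
  have sp: "special i \<longleftrightarrow> i = m - 1" for i using r k by (auto simp: special_def)
  have e: "nxt (m - 1) = 0" "(m - 1) mod k = r" "prv 0 = m - 1" "m - 1 - k = r"
      "nxt 0 = 1" "prv (m - 1) = m - 2" "(m - 2) mod k = r - 1"
    using r by (auto simp: nxt_def prv_def mod_if)
  have "M (m - 1) = L" by (simp add: M_def sp)
  also have "L = {0, 1}" by (rule set_eqI) (simp add: L_iff)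
  finally have Me: "M (m - 1) = {0, 1}" .
  then have Ne: "N (m - 1) = {1}" unfolding N_def Me e(1,2) using r by auto
  have Nn: "N i = window k (i mod k) (width i)" "card (N i) = width i" if "i < m - 1" for i
    using that N_normal[of i] card_N_normal[of i] by (auto simp: sp)
  have Pn: "P x = window k (x mod k) (width (prv x) - 1)" "card (P x) = width (prv x) - 1"
    if "0 < x" "x < m - 1" for x
    using that P_normal[of x] card_P_normal[of x] special_prv[of x] sp[of x] by auto
  have P0: "P 0 = {}" using e Me k r by (auto simp: P_def)
  have "k \<le> m - 2" "m - 2 \<noteq> m - 1" using r by linarith+
  then have "\<not> special (m - 2)" "T (m - 2)" "width (m - 2) = 1"
    by (simp_all add: sp T width)
  then have M2: "M (m - 2) = window k (r - 1) 1 \<union> {r - 1}"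
    by (simp add: M_def e(7) del: One_nat_def)
  have "1 \<notin> window k (r - 1) 1" using r by (auto simp: mem_window offset_def)
  then have Pe: "P (m - 1) = {}" unfolding P_def e(1,2,6,7) Me M2 by auto
  have one: "a = k - 1" if "window k a 1 = {1}" "a < k" for a
  proof -
    have "1 \<in> window k a 1" using that by simp
    then show ?thesis using that k by (auto simp: mem_window offset_def split: if_splits)
  qed
  show ?thesis
  proof (rule locating_coloring)
    fix i assume i: "i < m - 1"
    show "N i \<noteq> N (m - 1)"
    proof
      assume E: "N i = N (m - 1)"
      then have w: "width i = 1" using Ne Nn(2)[OF i] by simp
      then have "window k (i mod k) 1 = {1}" using E Ne Nn(1)[OF i] by simp
      then have a: "i mod k = k - 1" by (intro one) auto
      from w have "k \<le> i \<or> i + 2 = k" unfolding width by (simp split: if_splits)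
      then show False
      proof
        assume "k \<le> i"
        then have "i mod k = i - k" using i r by (simp add: mod_if)
        then show False using a i r by linarith
      next
        assume "i + 2 = k"
        then show False using a by simp
      qed
    qed
    show "P 0 \<noteq> N i" "P (m - 1) \<noteq> N i"
      using P0 Pe Nn(2)[OF i] width_bounds[of i] by auto
  next
    have "card (P k) = 1" using Pn(2)[of k] r k by (auto simp: prv_def width T)
    then show "P 0 \<noteq> P k" using P0 by auto
    have "card (P r) = 1" using Pn(2)[of r] r k by (auto simp: prv_def width T)
    then show "P (m - 1 - k) \<noteq> P (m - 1)" using Pe e by auto
  next
    fix x assume x: "x < m"
    show "P x \<noteq> N (m - 1)"
    proof
      assume E: "P x = N (m - 1)"
      then have x0: "0 < x" "x < m - 1"
        using P0 Pe Ne x by (cases "x = 0"; cases "x = m - 1"; auto)+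
      then have w: "width (prv x) = 2" using E Pn(2)[OF x0] Ne width_bounds(1)[of "prv x"] by simp
      then have "window k (x mod k) 1 = {1}" using E Ne Pn(1)[OF x0] by simp
      then have a: "x mod k = k - 1" by (intro one) auto
      from w have b: "\<not> k \<le> x - 1" "x - 1 + 2 \<noteq> k"
        using x0 unfolding width by (simp_all add: prv_def split: if_splits)
      then have "x \<le> k" by linarith
      then have "x = k - 1 \<or> x = k" using a by (cases "x = k") auto
      then show False using a b x0 k by auto
    qed
  qed
qed

end

context cycle_corona
begin

lemma locating_coloring_windows:
  assumes "2 \<le> n" "n + 2 \<le> k" "k \<le> m" "m \<le> 2 * k"
  shows "\<exists>c. locating_rainbow_coloring G k c"
proof -
  define q where "q = k - n"
  have q: "2 \<le> q" "q + 2 \<le> k" "n + q = k" using assms by (auto simp: q_def)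
  \<comment> \<open>For \<open>k < m < 2 * k\<close> this is the residue of the last cycle vertex
    \<open>m - 1\<close>.\<close>
  define r where "r = m - k - 1"
  consider "m = k \<or> m = 2 * k" | "m = k + 1"
    | "m = k + 1 + r" "1 \<le> r" "r + 2 \<le> k" "3 \<le> q \<or> r = 1"
    | "m = k + 1 + r" "2 \<le> r" "r + 2 \<le> k" "q = 2"
    using assms q unfolding r_def by linarith
  then show ?thesis
  proof cases
    case 1
    then interpret window_design m n k q "\<lambda>i. k \<le> i" "{..<q}"
      by unfold_locales (use assms q in auto)
    show ?thesis by (rule locating_coloring) (use 1 in auto)
  next
    case 2
    interpret window_design m n k q "\<lambda>i. k \<le> i" "insert (q + 1) {1..<q}"
      by unfold_locales (use assms q in auto)
    show ?thesis by (rule locating_coloring_one_more) (use 2 in auto)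
  next
    case 3
    \<comment> \<open>A set of \<open>q\<close> colours containing 0, \<open>r\<close> and, if
      \<open>r >= 2\<close>, also 1.\<close>
    let ?L = "if r < q then {..<q} else insert r {..<q - 1}"
    interpret window_design m n k q "\<lambda>i. k \<le> i" ?L
      by unfold_locales (use assms q 3 in auto)
    show ?thesis by (rule locating_coloring_long_wide[of r]) (use 3 q in auto)
  next
    case 4
    interpret window_design m n k q "\<lambda>i. k \<le> i \<or> i + 2 = k" "{0, 1}"
      by unfold_locales (use assms q 4 in auto)
    show ?thesis by (rule locating_coloring_long_narrow[of r]) (use 4 in auto)
  qed
qed

end

section \<open>The rainbow vertex locating number\<close>

lemma rvcl_eqI:
  assumes "\<exists>c. locating_rainbow_coloring G k c"
    and "\<And>l c. locating_rainbow_coloring G l c \<Longrightarrow> k \<le> l"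
  shows "rvcl G = k"
  unfolding rvcl_def using assms by (intro Least_equality) auto

theorem theorem7:
  fixes m n :: nat
  assumes "m \<ge> 3" and "n \<ge> 2"
  shows "(m = 3 \<or> (m \<ge> 4 \<and> n \<ge> m - 1) \<longrightarrow>
            rvcl (edge_corona (cycle_graph m) (complete_graph n)) = n + 1)
       \<and> (m \<ge> 4 \<and> nat \<lceil>real m / 2\<rceil> - 1 \<le> n \<and> n < m - 1 \<longrightarrow>
            rvcl (edge_corona (cycle_graph m) (complete_graph n))
              = max (nat \<lceil>real m / 2\<rceil> + 1) (n + 2))
       \<and> (m \<ge> 5 \<and> n + 2 \<le> nat \<lceil>real m / 2\<rceil> \<longrightarrow>
            rvcl (edge_corona (cycle_graph m) (complete_graph n)) = nat \<lceil>real m / 2\<rceil>)"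
proof -
  interpret cycle_corona m n by unfold_locales (use assms in auto)
  define h where "h = nat \<lceil>real m / 2\<rceil>"
  have h: "m \<le> 2 * h" "2 * h \<le> m + 1" unfolding h_def by linarith+
  have lower: "n < k" "k \<le> n + 1 \<Longrightarrow> m \<le> k" "m \<ge> 5 \<Longrightarrow> m \<le> 2 * k"
    if "locating_rainbow_coloring G k c" for k c
  proof -
    interpret located_cycle_corona m n k c by unfold_locales (rule that)
    show "n < k" "k \<le> n + 1 \<Longrightarrow> m \<le> k" "m \<ge> 5 \<Longrightarrow> m \<le> 2 * k"
      by (rule n_lt_k, erule m_le_k_if_few_colors, erule m_le_twice_k)
  qed
  have "rvcl G = n + 1" if "m = 3 \<or> (m \<ge> 4 \<and> n \<ge> m - 1)"
  proof (rule rvcl_eqI)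
    show "\<exists>c. locating_rainbow_coloring G (n + 1) c"
      using that assms by (intro locating_coloring_few_edges) auto
  next
    fix l c assume "locating_rainbow_coloring G l c"
    then show "n + 1 \<le> l" using lower(1) by fastforce
  qed
  moreover have "rvcl G = max (h + 1) (n + 2)" if "m \<ge> 4 \<and> h - 1 \<le> n \<and> n < m - 1"
  proof -
    \<comment> \<open>As \<open>h - 1 <= n\<close>, the maximum is \<open>n + 2\<close>. Fewer
      colours would give \<open>m <= n + 1\<close>.\<close>
    have "rvcl G = n + 2"
    proof (rule rvcl_eqI)
      show "\<exists>c. locating_rainbow_coloring G (n + 2) c"
        using that h assms by (intro locating_coloring_windows) auto
    next
      fix l c assume "locating_rainbow_coloring G l c"
      then show "n + 2 \<le> l" using lower(1,2)[of l c] that by linarith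
    qed
    moreover have "h + 1 \<le> n + 2" using that by linarith
    ultimately show ?thesis by (simp add: max.absorb2)
  qed
  moreover have "rvcl G = h" if "m \<ge> 5 \<and> n + 2 \<le> h"
  proof (rule rvcl_eqI)
    show "\<exists>c. locating_rainbow_coloring G h c"
      using that h assms by (intro locating_coloring_windows) auto
  next
    fix l c assume "locating_rainbow_coloring G l c"
    then show "h \<le> l" using lower(3)[of l c] that h by linarith
  qed
  ultimately show ?thesis unfolding h_def by blast
qed

end
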